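(* Let $j$ be a positive integer and consider $n=2j$ qubits. Run the following procedure (Algorithm 1): initialize all $2j$ qubits to $|0\rangle$ and set $m=j$; while $m\neq 0$, (i) apply the collective rotation $\exp(-i\theta_m J_y)$ with $\theta_m=\arcsin(m/j)$, (ii) perform a projective measurement of $J_z$ and set $m$ to the outcome, (iii) if $|m|>\sqrt{j}$, reset all qubits to $|0\rangle$ and set $m=j$. Then the procedure terminates with the system in the Dicke state $|j,0\rangle$, and the expected number of iterations of the while-loop is $O(\log j)$ as $j\to\infty$.
   Context: For $n$ qubits viewed as spin-$\tfrac12$ particles, let $\mathbf S_k$ be the spin operator of qubit $k$ and $\mathbf J=\sum_{k=1}^n \mathbf S_k$, with components $J_x,J_y,J_z$. The state $|0\rangle$ is spin up ($S_z=+\tfrac12$) and $|1\rangle$ is spin down. The Dicke state $|j,m\rangle$ (with $j=n/2$, $m\in\{-j,\dots,j\}$) is the uniform (equal-amplitude, normalized) superposition of all $n$-bit computational basis strings of Hamming weight $w=j-m$; it is a simultaneous eigenstate of $\mathbf J^2$ (eigenvalue $j(j+1)$) and $J_z$ (eigenvalue $m$). In particular $|j,j\rangle=|0\rangle^{\otimes n}$. A projective $J_z$ measurement on a permutation-symmetric state $\sum_m c_m|j,m\rangle$ yields outcome $m$ with probability $|c_m|^2$ and leaves the state $|j,m\rangle$. Each iteration of the while-loop counts as one unit of time. *)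

theory Defs
  imports Complex_Main "HOL-Library.Landau_Symbols"
begin

text \<open>Computational basis of n qubits: bit strings of length n
  (False = |0> = spin up, True = |1> = spin down).\<close>
definition bstrings :: "nat \<Rightarrow> bool list set" where
  "bstrings n = {xs. length xs = n}"

text \<open>Matrix element <x| S_y^(k) |y> of the spin-y operator of qubit k,
  S_y = sigma_y / 2 with <0|sigma_y|1> = -i, <1|sigma_y|0> = i.\<close>
definition Sy :: "nat \<Rightarrow> bool list \<Rightarrow> bool list \<Rightarrow> complex" where
  "Sy k x y = (if (\<forall>i<length x. i \<noteq> k \<longrightarrow> x ! i = y ! i) \<and> x ! k \<noteq> y ! k
               then (if x ! k then \<i> / 2 else - \<i> / 2) else 0)"

definition Jy :: "nat \<Rightarrow> bool list \<Rightarrow> bool list \<Rightarrow> complex" where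
  "Jy n x y = (\<Sum>k<n. Sy k x y)"

definition mmult :: "nat \<Rightarrow> (bool list \<Rightarrow> bool list \<Rightarrow> complex)
    \<Rightarrow> (bool list \<Rightarrow> bool list \<Rightarrow> complex) \<Rightarrow> bool list \<Rightarrow> bool list \<Rightarrow> complex" where
  "mmult n A B = (\<lambda>x y. \<Sum>z\<in>bstrings n. A x z * B z y)"

fun mpow :: "nat \<Rightarrow> (bool list \<Rightarrow> bool list \<Rightarrow> complex) \<Rightarrow> nat
    \<Rightarrow> bool list \<Rightarrow> bool list \<Rightarrow> complex" where
  "mpow n A 0 = (\<lambda>x y. if x = y then 1 else 0)"
| "mpow n A (Suc k) = mmult n (mpow n A k) A"

definition rot :: "nat \<Rightarrow> real \<Rightarrow> bool list \<Rightarrow> bool list \<Rightarrow> complex" where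
  "rot n \<theta> x y = (\<Sum>k. mpow n (\<lambda>a b. - \<i> * complex_of_real \<theta> * Jy n a b) k x y / of_nat (fact k))"

definition dicke :: "nat \<Rightarrow> nat \<Rightarrow> bool list \<Rightarrow> complex" where
  "dicke n w x = (if length x = n \<and> length (filter id x) = w
                  then complex_of_real (1 / sqrt (real (n choose w))) else 0)"

definition dicke_jm :: "nat \<Rightarrow> int \<Rightarrow> bool list \<Rightarrow> complex" where
  "dicke_jm j m = dicke (2 * j) (nat (int j - m))"

definition meas_prob :: "nat \<Rightarrow> real \<Rightarrow> int \<Rightarrow> int \<Rightarrow> real" where
  "meas_prob j \<theta> m m' =
     (cmod (\<Sum>x\<in>bstrings (2*j). \<Sum>y\<in>bstrings (2*j).
              cnj (dicke_jm j m' x) * rot (2*j) \<theta> x y * dicke_jm j m y))\<^sup>2"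

definition theta :: "nat \<Rightarrow> int \<Rightarrow> real" where
  "theta j m = arcsin (real_of_int m / real j)"

definition step_prob :: "nat \<Rightarrow> int \<Rightarrow> int \<Rightarrow> real" where
  "step_prob j m m'' = (\<Sum>m'\<in>{- int j..int j}.
      (if (if real_of_int \<bar>m'\<bar> > sqrt (real j) then int j else m') = m''
       then meas_prob j (theta j m) m m' else 0))"

text \<open>run j t m: probability that the loop has executed t iterations without having
  terminated before, and the current value is m (the state then being |j,m>).\<close>
fun run :: "nat \<Rightarrow> nat \<Rightarrow> int \<Rightarrow> real" where
  "run j 0 m = (if m = int j then 1 else 0)"
| "run j (Suc t) m'' = (\<Sum>m\<in>{- int j..int j} - {0}. run j t m * step_prob j m m'')"

definition still_running :: "nat \<Rightarrow> nat \<Rightarrow> real" where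
  "still_running j t = (\<Sum>m\<in>{- int j..int j} - {0}. run j t m)"

text \<open>E[N] = sum_{t >= 0} P(N > t).\<close>
definition expected_iterations :: "nat \<Rightarrow> real" where
  "expected_iterations j = (\<Sum>t. still_running j t)"

end

theory Submission
  imports Defs "HOL-Computational_Algebra.Polynomial"
begin

text \<open>
  The rotation is a tensor power of a \<open>2 \<times> 2\<close> rotation, so the probability generating function
  of the measured Hamming weight is a coefficient of
  \<open>(A + B z)\<^bsup>n-w\<^esup> (B + E z)\<^bsup>w\<^esup>\<close> with \<open>A, B, E\<close> affine in the formal variable.
  Expanding at \<open>1\<close> gives the first four central moments of the outcome exactly.

  For large \<open>j\<close>, starting from \<open>\<bar>m\<bar> \<le> \<surd>j\<close>, the ratio \<open>y = m' / m\<close> has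
  mean about \<open>1\<close>, variance about \<open>1/2\<close> and fourth central moment about
  \<open>3/8 + 1/(2 m\<^sup>2)\<close> (classically, \<open>y = 1 + cos \<phi>\<close> with a uniform phase).
  A quartic majorant of \<open>\<surd>\<bar>y\<bar>\<close> then shows that \<open>\<surd>\<bar>m\<bar>\<close>
  contracts in expectation by a constant factor. Truncating at \<open>j\<^bsup>1/4\<^esup>\<close>,
  the value given to the reset state, yields a potential on which every step contracts, the step
  from the reset state by AM-GM and the second moment \<open>j/2\<close>. Hence
  \<open>P(N > t) \<le> min 1 (\<rho>\<^bsup>t\<^esup> j\<^bsup>1/4\<^esup>)\<close>,
  which sums to \<open>O(log j)\<close>.
\<close>

section \<open>The collective rotation as a tensor power\<close>

lemma finite_bstrings [simp]: "finite (bstrings n)"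
  unfolding bstrings_def using finite_lists_length_eq[of "UNIV :: bool set" n] by simp

lemma bstrings_0 [simp]: "bstrings 0 = {[]}"
  by (auto simp: bstrings_def)

lemma sum_bstrings_Suc:
  "(\<Sum>z\<in>bstrings (Suc n). f z) = (\<Sum>z\<in>bstrings n. f (True # z) + f (False # z))"
proof -
  have eq: "bstrings (Suc n) = (Cons True) ` bstrings n \<union> (Cons False) ` bstrings n"
    by (auto simp: bstrings_def length_Suc_conv image_iff) 
  have "sum f (bstrings (Suc n)) = sum f ((Cons True) ` bstrings n) + sum f ((Cons False) ` bstrings n)"
    unfolding eq by (rule sum.union_disjoint) auto
  then show ?thesis
    by (simp add: sum.reindex sum.distrib)
qed

definition weight :: "bool list \<Rightarrow> nat" where
  "weight x = length (filter id x)"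

lemma weight_simps [simp]: "weight [] = 0" "weight (a # x) = (if a then Suc (weight x) else weight x)"
  by (simp_all add: weight_def)

lemma weight_le_length: "weight x \<le> length x"
  by (simp add: weight_def)

lemma card_weight: "card {x \<in> bstrings n. weight x = w} = n choose w"
proof (induction n arbitrary: w)
  case 0
  have "{x \<in> bstrings 0. weight x = w} = (if w = 0 then {[]} else {})" by auto
  then show ?case by (simp only:) (cases w; simp)
next
  case (Suc n)
  have "card {x \<in> bstrings (Suc n). weight x = w} = (\<Sum>x\<in>bstrings (Suc n). if weight x = w then 1 else 0)"
    by (simp add: sum.If_cases Int_def)
  also have "\<dots> = (\<Sum>x\<in>bstrings n. if Suc (weight x) = w then 1 else 0) + (\<Sum>x\<in>bstrings n. if weight x = w then 1 else 0)"
    by (simp add: sum_bstrings_Suc sum.distrib)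
  also have "\<dots> = (Suc n choose w)"
    using Suc[of w] Suc[of "w - 1"] by (cases w) (simp_all add: sum.If_cases Int_def)
  finally show ?case .
qed

section \<open>Tensor powers and the generator of the rotation\<close>

fun tensor_mat :: "(bool \<Rightarrow> bool \<Rightarrow> 'a::comm_semiring_1) \<Rightarrow> bool list \<Rightarrow> bool list \<Rightarrow> 'a" where
  "tensor_mat g (a # x) (b # y) = g a b * tensor_mat g x y"
| "tensor_mat g _ _ = 1"

text \<open>The matrix of exp(-i \<theta> S_y) for one qubit; the first argument is the row. It is
  real, so the rotation can be treated over the reals.\<close>

definition qubit_rot :: "real \<Rightarrow> bool \<Rightarrow> bool \<Rightarrow> real" where
  "qubit_rot \<theta> a b = (if a = b then cos (\<theta>/2) else if a then sin (\<theta>/2) else - sin (\<theta>/2))"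

text \<open>The matrix of -i S_y, the derivative of \<open>qubit_rot\<close> at angle 0.\<close>

definition qubit_gen :: "bool \<Rightarrow> bool \<Rightarrow> real" where
  "qubit_gen a b = (if a = b then 0 else if a then 1/2 else -1/2)"

text \<open>The matrix of -i J_y with the first qubit split off: k \<otimes> 1 + 1 \<otimes> K,
  where k is \<open>qubit_gen\<close> and K acts on the remaining qubits.\<close>

fun gen_mat :: "bool list \<Rightarrow> bool list \<Rightarrow> real" where
  "gen_mat (a # x) (b # y) = (if x = y then qubit_gen a b else 0) + (if a = b then gen_mat x y else 0)"
| "gen_mat _ _ = 0"

lemma Jy_eq_gen_mat:
  assumes "length x = n" "length y = n"
  shows "- \<i> * Jy n x y = complex_of_real (gen_mat x y)"
  using assms
proof (induction n arbitrary: x y)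
  case 0
  then show ?case by (simp add: Jy_def)
next
  case (Suc n)
  obtain a u where x: "x = a # u" "length u = n" using Suc.prems(1) by (cases x) auto
  obtain b v where y: "y = b # v" "length v = n" using Suc.prems(2) by (cases y) auto
  have all0: "(\<forall>i<Suc n. i \<noteq> 0 \<longrightarrow> (a # u) ! i = (b # v) ! i) \<longleftrightarrow> u = v"
    using x y by (auto simp: All_less_Suc2 list_eq_iff_nth_eq)
  have S0: "Sy 0 x y = (if u = v \<and> a \<noteq> b then (if a then \<i> / 2 else - \<i> / 2) else 0)"
    unfolding Sy_def using x y all0 by simp
  have allS: "(\<forall>i<Suc n. i \<noteq> Suc k \<longrightarrow> (a # u) ! i = (b # v) ! i) \<longleftrightarrow>
      a = b \<and> (\<forall>i<n. i \<noteq> k \<longrightarrow> u ! i = v ! i)" for k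
    by (auto simp: All_less_Suc2)
  have SS: "Sy (Suc k) x y = (if a = b then Sy k u v else 0)" for k
    unfolding Sy_def x(1) y(1) length_Cons x(2) allS by auto
  have "Jy (Suc n) x y = Sy 0 x y + (if a = b then Jy n u v else 0)"
    unfolding Jy_def sum.lessThan_Suc_shift SS by simp
  then have "- \<i> * Jy (Suc n) x y = - \<i> * Sy 0 x y + (if a = b then - \<i> * Jy n u v else 0)"
    by (simp add: algebra_simps)
  also have "\<dots> = complex_of_real (gen_mat x y)"
    unfolding S0 unfolding x(1) y(1) using Suc.IH[OF x(2) y(2)] by (simp add: qubit_gen_def)
  finally show ?case .
qed

lemma qubit_rot_has_deriv:
  "((\<lambda>t. qubit_rot t a b) has_real_derivative (qubit_gen a True * qubit_rot t True b + qubit_gen a False * qubit_rot t False b)) (at t)"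
  unfolding qubit_rot_def qubit_gen_def
  by (cases a; cases b) (auto intro!: derivative_eq_intros)

text \<open>The product rule matches the recursion of \<open>gen_mat\<close>: differentiating the
  head factor gives the term with equal tails, differentiating the tail factor the term with equal
  heads.\<close>

lemma tensor_rot_has_deriv:
  assumes "length x = n" "length y = n"
  shows "((\<lambda>t. tensor_mat (qubit_rot t) x y) has_real_derivative (\<Sum>z\<in>bstrings n. gen_mat x z * tensor_mat (qubit_rot t) z y)) (at t)"
  using assms
proof (induction n arbitrary: x y)
  case 0
  then show ?case by simp
next
  case (Suc n)
  obtain a u where x: "x = a # u" "length u = n" using Suc.prems(1) by (cases x) auto
  obtain b v where y: "y = b # v" "length v = n" using Suc.prems(2) by (cases y) auto
  have u: "u \<in> bstrings n" using x by (simp add: bstrings_def)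
  have pick: "(\<Sum>z\<in>bstrings n. (if u = z then c else 0) * f z) = c * f u" for c :: real and f
    using u by (simp add: if_distrib[of "\<lambda>q. q * _"] sum.delta cong: if_cong)
  have "(\<Sum>z\<in>bstrings (Suc n). gen_mat x z * tensor_mat (qubit_rot t) z y)
     = (\<Sum>z\<in>bstrings n. (if u = z then qubit_gen a True * qubit_rot t True b + qubit_gen a False * qubit_rot t False b else 0) * tensor_mat (qubit_rot t) z v
          + qubit_rot t a b * (gen_mat u z * tensor_mat (qubit_rot t) z v))"
    unfolding sum_bstrings_Suc x(1) y(1)
    by (rule sum.cong) (cases a; auto simp: algebra_simps)+
  also have "\<dots> = (qubit_gen a True * qubit_rot t True b + qubit_gen a False * qubit_rot t False b) * tensor_mat (qubit_rot t) u v
      + qubit_rot t a b * (\<Sum>z\<in>bstrings n. gen_mat u z * tensor_mat (qubit_rot t) z v)"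
    by (simp add: sum.distrib pick sum_distrib_left)
  finally have eq: "(\<Sum>z\<in>bstrings (Suc n). gen_mat x z * tensor_mat (qubit_rot t) z y) = \<dots>" .
  show ?case
    unfolding eq unfolding x(1) y(1) tensor_mat.simps
    by (rule DERIV_cong[OF DERIV_mult[OF qubit_rot_has_deriv Suc.IH[OF x(2) y(2)]]]) (simp add: algebra_simps)
qed

section \<open>Exponential series of the generator\<close>

fun gen_pow :: "nat \<Rightarrow> nat \<Rightarrow> bool list \<Rightarrow> bool list \<Rightarrow> real" where
  "gen_pow n 0 x y = (if x = y then 1 else 0)"
| "gen_pow n (Suc k) x y = (\<Sum>z\<in>bstrings n. gen_pow n k x z * gen_mat z y)"

lemma mpow_eq_gen_pow:
  assumes "x \<in> bstrings n" "y \<in> bstrings n"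
  shows "mpow n (\<lambda>a b. - \<i> * complex_of_real \<theta> * Jy n a b) k x y = complex_of_real (\<theta> ^ k * gen_pow n k x y)"
  using assms
proof (induction k arbitrary: y)
  case 0
  then show ?case by simp
next
  case (Suc k)
  have "mpow n (\<lambda>a b. - \<i> * complex_of_real \<theta> * Jy n a b) k x z * (- \<i> * complex_of_real \<theta> * Jy n z y)
      = complex_of_real (\<theta> ^ Suc k * (gen_pow n k x z * gen_mat z y))" if z: "z \<in> bstrings n" for z
  proof -
    have "- \<i> * complex_of_real \<theta> * Jy n z y = complex_of_real \<theta> * (- \<i> * Jy n z y)" by simp
    also have "\<dots> = complex_of_real (\<theta> * gen_mat z y)"
      using Jy_eq_gen_mat[of z n y] z Suc.prems by (simp add: bstrings_def)
    finally show ?thesis using Suc.IH[OF Suc.prems(1) z] by simp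
  qed
  then show ?case
    by (simp add: mmult_def sum_distrib_left del: of_real_mult of_real_power)
qed

lemma abs_gen_mat_le: "\<bar>gen_mat x y\<bar> \<le> real (length x)"
proof (induction x y rule: gen_mat.induct)
  case (1 a x b y)
  have "\<bar>qubit_gen a b\<bar> \<le> 1" by (simp add: qubit_gen_def)
  with 1 show ?case by (auto split: if_splits)
qed auto

text \<open>Crude on purpose: any geometric growth in \<open>k\<close> suffices, because the
  Maclaurin remainder is divided by a factorial.\<close>

lemma abs_gen_pow_le: "\<bar>gen_pow n k x y\<bar> \<le> (real (card (bstrings n)) * real n) ^ k"
proof (induction k arbitrary: y)
  case (Suc k)
  have "\<bar>gen_pow n (Suc k) x y\<bar> \<le> (\<Sum>z\<in>bstrings n. \<bar>gen_pow n k x z * gen_mat z y\<bar>)"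
    by simp
  also have "\<dots> \<le> (\<Sum>z\<in>bstrings n. (real (card (bstrings n)) * real n) ^ k * real n)"
  proof (rule sum_mono)
    fix z assume "z \<in> bstrings n"
    then show "\<bar>gen_pow n k x z * gen_mat z y\<bar> \<le> (real (card (bstrings n)) * real n) ^ k * real n"
      unfolding abs_mult using abs_gen_mat_le[of z y] Suc.IH[of z]
      by (intro mult_mono) (auto simp: bstrings_def)
  qed
  finally show ?case by (simp add: mult_ac)
qed simp

lemma abs_tensor_rot_le: "\<bar>tensor_mat (qubit_rot t) x y\<bar> \<le> 1"
proof (induction "qubit_rot t" x y rule: tensor_mat.induct)
  case (1 a x b y)
  have "\<bar>qubit_rot t a b\<bar> \<le> 1" by (simp add: qubit_rot_def)
  with 1 show ?case by (auto simp: abs_mult intro: mult_le_one)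
qed auto

lemma tensor_rot_0: "length x = length y \<Longrightarrow> tensor_mat (qubit_rot 0) x y = (if x = y then 1 else 0)"
  by (induction x y rule: list_induct2) (auto simp: qubit_rot_def)

text \<open>Since the product \<open>tensor_mat (qubit_rot t)\<close> satisfies the linear equation
  \<open>F' = K F\<close> with \<open>K = - i J\<^sub>y\<close>, its Maclaurin series is the exponential series.\<close>

lemma tensor_rot_sums:
  assumes x: "x \<in> bstrings n" and y: "y \<in> bstrings n"
  shows "(\<lambda>k. \<theta> ^ k * gen_pow n k x y / fact k) sums tensor_mat (qubit_rot \<theta>) x y"
proof -
  \<comment> \<open>The entry of K^k F(t) at \<open>x\<close>, \<open>y\<close>, which is the
    \<open>k\<close>-th derivative of the entry of F.\<close>
  define D where "D k t = (\<Sum>z\<in>bstrings n. gen_pow n k x z * tensor_mat (qubit_rot t) z y)" for k t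
  define c where "c = real (card (bstrings n))"
  define M where "M = c * real n"
  have D0: "D 0 t = tensor_mat (qubit_rot t) x y" for t
    unfolding D_def using x by (simp add: if_distrib[of "\<lambda>q. q * _"] sum.delta' cong: if_cong)
  have Dder: "DERIV (D k) t :> D (Suc k) t" for k t
  proof -
    have "((\<lambda>t. \<Sum>z\<in>bstrings n. gen_pow n k x z * tensor_mat (qubit_rot t) z y) has_real_derivative
       (\<Sum>z\<in>bstrings n. gen_pow n k x z * (\<Sum>v\<in>bstrings n. gen_mat z v * tensor_mat (qubit_rot t) v y))) (at t)"
      using y by (intro DERIV_sum DERIV_cmult tensor_rot_has_deriv) (auto simp: bstrings_def)
    also have "(\<Sum>z\<in>bstrings n. gen_pow n k x z * (\<Sum>v\<in>bstrings n. gen_mat z v * tensor_mat (qubit_rot t) v y))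
        = (\<Sum>v\<in>bstrings n. gen_pow n (Suc k) x v * tensor_mat (qubit_rot t) v y)"
      unfolding sum_distrib_left gen_pow.simps sum_distrib_right by (subst sum.swap) (simp add: mult_ac)
    finally show ?thesis unfolding D_def .
  qed
  have Dk0: "D k 0 = gen_pow n k x y" for k
  proof -
    have "D k 0 = (\<Sum>z\<in>bstrings n. gen_pow n k x z * (if z = y then 1 else 0))"
      unfolding D_def using y by (intro sum.cong) (auto simp: tensor_rot_0 bstrings_def)
    then show ?thesis using y by (simp add: if_distrib[of "\<lambda>q. _ * q"] sum.delta cong: if_cong)
  qed
  have Dbound: "\<bar>D k t\<bar> \<le> c * M ^ k" for k t
  proof -
    have "\<bar>D k t\<bar> \<le> (\<Sum>z\<in>bstrings n. \<bar>gen_pow n k x z * tensor_mat (qubit_rot t) z y\<bar>)"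
      unfolding D_def by simp
    also have "\<dots> \<le> (\<Sum>z\<in>bstrings n. M ^ k * 1)"
      unfolding abs_mult M_def c_def
      by (intro sum_mono mult_mono abs_gen_pow_le abs_tensor_rot_le) auto
    finally show ?thesis by (simp add: c_def)
  qed
  have rem: "\<bar>tensor_mat (qubit_rot \<theta>) x y - (\<Sum>k<N. \<theta> ^ k * gen_pow n k x y / fact k)\<bar> \<le> c * ((M * \<bar>\<theta>\<bar>) ^ N / fact N)" for N
  proof -
    have "\<exists>t. \<bar>t\<bar> \<le> \<bar>\<theta>\<bar> \<and> D 0 \<theta> = (\<Sum>m<N. D m 0 / fact m * \<theta> ^ m) + D N t / fact N * \<theta> ^ N"
      using Maclaurin_all_le[of D "D 0" \<theta> N] Dder by auto
    then obtain t where t: "D 0 \<theta> = (\<Sum>m<N. D m 0 / fact m * \<theta> ^ m) + D N t / fact N * \<theta> ^ N"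
      by blast
    then have "\<bar>tensor_mat (qubit_rot \<theta>) x y - (\<Sum>k<N. \<theta> ^ k * gen_pow n k x y / fact k)\<bar> = \<bar>D N t\<bar> * (\<bar>\<theta>\<bar> ^ N / fact N)"
      by (simp add: D0 Dk0 abs_mult power_abs mult_ac)
    also have "\<dots> \<le> (c * M ^ N) * (\<bar>\<theta>\<bar> ^ N / fact N)"
      by (intro mult_right_mono Dbound) auto
    finally show ?thesis by (simp add: power_mult_distrib mult_ac)
  qed
  have "(\<lambda>N. c * ((M * \<bar>\<theta>\<bar>) ^ N / fact N)) \<longlonglongrightarrow> c * 0"
    using summable_LIMSEQ_zero[OF summable_exp[of "M * \<bar>\<theta>\<bar>"]]
    by (intro tendsto_mult tendsto_const) (simp add: field_simps)
  then have lim: "(\<lambda>N. c * ((M * \<bar>\<theta>\<bar>) ^ N / fact N)) \<longlonglongrightarrow> 0" by simp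
  have "(\<lambda>N. tensor_mat (qubit_rot \<theta>) x y - (\<Sum>k<N. \<theta> ^ k * gen_pow n k x y / fact k)) \<longlonglongrightarrow> 0"
    by (rule tendsto_rabs_zero_cancel, rule tendsto_sandwich[OF _ _ tendsto_const lim]) (use rem in auto)
  then have "(\<lambda>N. tensor_mat (qubit_rot \<theta>) x y - (tensor_mat (qubit_rot \<theta>) x y - (\<Sum>k<N. \<theta> ^ k * gen_pow n k x y / fact k))) \<longlonglongrightarrow> tensor_mat (qubit_rot \<theta>) x y - 0"
    by (intro tendsto_intros)
  then show ?thesis by (simp add: sums_def)
qed

lemma rot_eq_tensor_mat:
  assumes x: "x \<in> bstrings n" and y: "y \<in> bstrings n"
  shows "rot n \<theta> x y = complex_of_real (tensor_mat (qubit_rot \<theta>) x y)"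
proof -
  have "(\<lambda>k. complex_of_real (\<theta> ^ k * gen_pow n k x y / fact k)) sums complex_of_real (tensor_mat (qubit_rot \<theta>) x y)"
    using tensor_rot_sums[OF assms] by (subst sums_of_real_iff)
  then show ?thesis
    unfolding rot_def mpow_eq_gen_pow[OF assms] by (simp add: sums_iff)
qed

section \<open>Generating function of the outcome\<close>

text \<open>The qubits contribute independently. Each bit of \<open>x\<close> selects a row of
  \<open>g\<close>, read as a linear polynomial whose variable marks an output bit
  \<open>True\<close>.\<close>

lemma sum_monom_tensor_mat:
  fixes g :: "bool \<Rightarrow> bool \<Rightarrow> 'a::comm_ring_1"
  assumes "length x = n"
  shows "(\<Sum>y\<in>bstrings n. monom (tensor_mat g x y) (weight y)) =
    [:g False False, g False True:] ^ (n - weight x) * [:g True False, g True True:] ^ weight x"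
  using assms
proof (induction n arbitrary: x)
  case 0
  then show ?case by (simp add: monom_0 one_pCons)
next
  case (Suc n)
  obtain a u where x: "x = a # u" "length u = n" using Suc.prems by (cases x) auto
  have "monom (tensor_mat g x (True # y)) (weight (True # y)) + monom (tensor_mat g x (False # y)) (weight (False # y))
      = [:g a False, g a True:] * monom (tensor_mat g u y) (weight y)" for y
    by (simp add: x(1) monom_Suc smult_monom add.commute)
  then have "(\<Sum>y\<in>bstrings (Suc n). monom (tensor_mat g x y) (weight y))
      = [:g a False, g a True:] * (\<Sum>y\<in>bstrings n. monom (tensor_mat g u y) (weight y))"
    unfolding sum_bstrings_Suc by (simp only: sum_distrib_left)
  also have "\<dots> = [:g a False, g a True:] *
      ([:g False False, g False True:] ^ (n - weight u) * [:g True False, g True True:] ^ weight u)"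
    using Suc.IH[OF x(2)] by simp
  also have "\<dots> = [:g False False, g False True:] ^ (Suc n - weight x) * [:g True False, g True True:] ^ weight x"
    using weight_le_length[of u] x by (cases a) (simp_all only: weight_simps if_True if_False Suc_diff_le diff_Suc_Suc power_Suc mult_ac x(2))
  finally show ?case .
qed

section \<open>Shells of constant Hamming weight\<close>

definition shells :: "nat \<Rightarrow> nat \<Rightarrow> bool list set" where
  "shells n w = {x \<in> bstrings n. weight x = w}"

lemma finite_shells [simp]: "finite (shells n w)"
  by (simp add: shells_def)

lemma card_shells: "card (shells n w) = n choose w"
  by (simp add: shells_def card_weight)

text \<open>The sum of one row of the tensor power over the columns of weight \<open>w\<close>; it
  depends on the row only through its weight \<open>v\<close>.\<close>

definition shell_sum :: "(bool \<Rightarrow> bool \<Rightarrow> 'a::comm_ring_1) \<Rightarrow> nat \<Rightarrow> nat \<Rightarrow> nat \<Rightarrow> 'a" where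
  "shell_sum g n v w =
     coeff ([:g False False, g False True:] ^ (n - v) * [:g True False, g True True:] ^ v) w"

lemma sum_tensor_mat_shells:
  assumes "x \<in> bstrings n"
  shows "(\<Sum>y\<in>shells n w. tensor_mat g x y) = shell_sum g n (weight x) w"
proof -
  have "shell_sum g n (weight x) w = coeff (\<Sum>y\<in>bstrings n. monom (tensor_mat g x y) (weight y)) w"
    using assms sum_monom_tensor_mat[of x n g] by (simp add: shell_sum_def bstrings_def)
  also have "\<dots> = (\<Sum>y\<in>bstrings n. if weight y = w then tensor_mat g x y else 0)"
    by (simp add: coeff_sum)
  finally show ?thesis
    by (simp add: shells_def sum.inter_filter)
qed

text \<open>The 2 \<times> 2 matrix r^T diag(1, q) r.\<close>

definition gram :: "'a \<Rightarrow> (bool \<Rightarrow> bool \<Rightarrow> 'a::comm_ring_1) \<Rightarrow> bool \<Rightarrow> bool \<Rightarrow> 'a" where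
  "gram q r b c = r False b * r False c + q * r True b * r True c"

text \<open>The weighting \<open>q ^ weight x\<close> is itself the tensor power of diag(1, q), and
  a product of tensor powers is the tensor power of the product.\<close>

lemma sum_tensor_mat_gram:
  assumes "length y = n" "length z = n"
  shows "(\<Sum>x\<in>bstrings n. q ^ weight x * (tensor_mat r x y * tensor_mat r x z)) = tensor_mat (gram q r) y z"
  using assms
proof (induction n arbitrary: y z)
  case 0
  then show ?case by simp
next
  case (Suc n)
  obtain b u where y: "y = b # u" "length u = n" using Suc.prems(1) by (cases y) auto
  obtain c v where z: "z = c # v" "length v = n" using Suc.prems(2) by (cases z) auto
  have "(\<Sum>x\<in>bstrings (Suc n). q ^ weight x * (tensor_mat r x y * tensor_mat r x z))
     = (\<Sum>x\<in>bstrings n. gram q r b c * (q ^ weight x * (tensor_mat r x u * tensor_mat r x v)))"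
    unfolding sum_bstrings_Suc y(1) z(1)
    by (rule sum.cong) (simp_all add: gram_def algebra_simps)
  also have "\<dots> = gram q r b c * tensor_mat (gram q r) u v"
    using Suc.IH[OF y(2) z(2)] by (simp add: sum_distrib_left[symmetric])
  finally show ?case by (simp add: y z)
qed

lemma sum_shells_if:
  "(\<Sum>x\<in>bstrings n. if x \<in> shells n w then f x else 0) = sum f (shells n w)"
  by (rule sum.mono_neutral_cong_right) (auto simp: shells_def)

text \<open>The transition probability from weight \<open>w\<close> to weight \<open>v\<close>: the
  square of the amplitude \<open>shell_sum\<close> times (n choose v), divided by both Dicke
  normalizations.\<close>

definition shell_prob :: "nat \<Rightarrow> real \<Rightarrow> nat \<Rightarrow> nat \<Rightarrow> real" where
  "shell_prob n \<theta> w v = real (n choose v) * (shell_sum (qubit_rot \<theta>) n v w)\<^sup>2 / real (n choose w)"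

lemma sum_over_shells:
  "(\<Sum>x\<in>bstrings n. f x) = (\<Sum>v\<le>n. \<Sum>x\<in>shells n v. f x)"
proof -
  have "(\<Sum>v\<in>{..n}. \<Sum>x\<in>{x\<in>bstrings n. weight x = v}. f x) = sum f (bstrings n)"
    by (rule sum.group) (simp, simp, auto simp: bstrings_def weight_le_length)
  then show ?thesis by (simp add: shells_def)
qed

text \<open>The squared amplitude is a double sum over columns \<open>y\<close>, \<open>z\<close> of
  weight \<open>w\<close>. Summing over the rows first produces the Gram matrix. The sum over
  \<open>z\<close> is then the same for every \<open>y\<close> in the shell, which cancels the
  denominator (n choose w).\<close>

lemma shell_prob_pgf:
  assumes "w \<le> n"
  shows "(\<Sum>v\<le>n. shell_prob n \<theta> w v * q ^ v) = shell_sum (gram q (qubit_rot \<theta>)) n w w"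
proof -
  let ?r = "qubit_rot \<theta>"
  have pos: "real (n choose w) > 0" using assms by simp
  have "real (n choose w) * (\<Sum>v\<le>n. shell_prob n \<theta> w v * q ^ v)
      = (\<Sum>v\<le>n. real (n choose v) * (shell_sum ?r n v w)\<^sup>2 * q ^ v)"
    using pos by (simp add: shell_prob_def sum_distrib_left mult_ac)
  also have "\<dots> = (\<Sum>v\<le>n. \<Sum>x\<in>shells n v. q ^ weight x * (shell_sum ?r n (weight x) w)\<^sup>2)"
    by (intro sum.cong) (auto simp: shells_def card_weight)
  also have "\<dots> = (\<Sum>x\<in>bstrings n. q ^ weight x * (shell_sum ?r n (weight x) w)\<^sup>2)"
    by (rule sum_over_shells[symmetric])
  also have "\<dots> = (\<Sum>x\<in>bstrings n. q ^ weight x * ((\<Sum>y\<in>shells n w. tensor_mat ?r x y) * (\<Sum>z\<in>shells n w. tensor_mat ?r x z)))"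
    by (intro sum.cong) (auto simp: sum_tensor_mat_shells power2_eq_square)
  also have "\<dots> = (\<Sum>x\<in>bstrings n. \<Sum>y\<in>shells n w. \<Sum>z\<in>shells n w. q ^ weight x * (tensor_mat ?r x y * tensor_mat ?r x z))"
    unfolding sum_product unfolding sum_distrib_left ..
  also have "\<dots> = (\<Sum>y\<in>shells n w. \<Sum>z\<in>shells n w. \<Sum>x\<in>bstrings n. q ^ weight x * (tensor_mat ?r x y * tensor_mat ?r x z))"
    by (subst sum.swap) (intro sum.cong refl sum.swap)
  also have "\<dots> = (\<Sum>y\<in>shells n w. \<Sum>z\<in>shells n w. tensor_mat (gram q ?r) y z)"
    by (intro sum.cong refl sum_tensor_mat_gram) (auto simp: shells_def bstrings_def)
  also have "\<dots> = (\<Sum>y\<in>shells n w. shell_sum (gram q ?r) n w w)"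
    by (intro sum.cong refl, subst sum_tensor_mat_shells) (auto simp: shells_def)
  also have "\<dots> = real (n choose w) * shell_sum (gram q ?r) n w w"
    by (simp add: card_shells)
  finally show ?thesis using pos by simp
qed

section \<open>Measurement probabilities of Dicke states\<close>

lemma dicke_eq:
  assumes "x \<in> bstrings n"
  shows "dicke n w x = complex_of_real (if x \<in> shells n w then 1 / sqrt (real (n choose w)) else 0)"
  using assms by (simp add: dicke_def shells_def weight_def bstrings_def)

text \<open>Both Dicke states are constant on their shells, so the amplitude is a sum of rotation
  entries over two shells, and the inner sum is the same for every row of the outer shell.\<close>

lemma meas_prob_eq_shell_prob:
  assumes "m \<in> {- int j..int j}" "m' \<in> {- int j..int j}"
  shows "meas_prob j \<theta> m m' = shell_prob (2*j) \<theta> (nat (int j - m)) (nat (int j - m'))"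
proof -
  define n w v where "n = 2*j" and "w = nat (int j - m)" and "v = nat (int j - m')"
  let ?cw = "1 / sqrt (real (n choose w))" and ?cv = "1 / sqrt (real (n choose v))"
  have "w \<le> n" "v \<le> n" using assms by (auto simp: n_def w_def v_def)
  then have pos: "real (n choose w) > 0" "real (n choose v) > 0" by simp_all
  have "(\<Sum>x\<in>bstrings n. \<Sum>y\<in>bstrings n. cnj (dicke n v x) * rot n \<theta> x y * dicke n w y)
     = (\<Sum>x\<in>bstrings n. \<Sum>y\<in>bstrings n. complex_of_real
         (if x \<in> shells n v then if y \<in> shells n w then ?cv * ?cw * tensor_mat (qubit_rot \<theta>) x y else 0 else 0))"
    by (intro sum.cong refl) (simp add: dicke_eq rot_eq_tensor_mat)
  also have "\<dots> = complex_of_real (\<Sum>x\<in>bstrings n. if x \<in> shells n v then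
      (\<Sum>y\<in>bstrings n. if y \<in> shells n w then ?cv * ?cw * tensor_mat (qubit_rot \<theta>) x y else 0) else 0)"
    unfolding of_real_sum by (intro sum.cong refl) auto
  also have "(\<Sum>x\<in>bstrings n. if x \<in> shells n v then
      (\<Sum>y\<in>bstrings n. if y \<in> shells n w then ?cv * ?cw * tensor_mat (qubit_rot \<theta>) x y else 0) else 0)
      = (\<Sum>x\<in>shells n v. \<Sum>y\<in>shells n w. ?cv * ?cw * tensor_mat (qubit_rot \<theta>) x y)"
    by (simp only: sum_shells_if)
  also have "\<dots> = (\<Sum>x\<in>shells n v. ?cv * ?cw * shell_sum (qubit_rot \<theta>) n v w)"
    by (intro sum.cong refl, subst sum_distrib_left[symmetric], subst sum_tensor_mat_shells) (auto simp: shells_def)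
  also have "\<dots> = real (n choose v) * (?cv * ?cw * shell_sum (qubit_rot \<theta>) n v w)"
    by (simp add: card_shells)
  finally have amp: "(\<Sum>x\<in>bstrings n. \<Sum>y\<in>bstrings n. cnj (dicke n v x) * rot n \<theta> x y * dicke n w y)
     = complex_of_real (real (n choose v) * (?cv * ?cw * shell_sum (qubit_rot \<theta>) n v w))" .
  have "meas_prob j \<theta> m m' = (real (n choose v) * (?cv * ?cw * shell_sum (qubit_rot \<theta>) n v w))\<^sup>2"
    unfolding meas_prob_def dicke_jm_def w_def[symmetric] v_def[symmetric] n_def[symmetric] amp norm_of_real
    by (rule power2_abs)
  also have "\<dots> = shell_prob n \<theta> w v"
    using pos unfolding shell_prob_def power_mult_distrib power_divide
    by (simp add: power2_eq_square)
  finally show ?thesis by (simp add: n_def w_def v_def)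
qed

section \<open>Moments of the outcome\<close>

lemma coeff_linear_power_all:
  fixes a b :: "'a::comm_ring_1"
  shows "coeff ([:a, b:] ^ n) i = of_nat (n choose i) * b ^ i * a ^ (n - i)"
proof (cases "i \<le> n")
  case True
  then show ?thesis by (rule coeff_linear_poly_power)
next
  case False
  have "degree ([:a, b:] ^ n) \<le> degree [:a, b:] * n" by (rule degree_power_le)
  also have "\<dots> \<le> 1 * n" by (rule mult_right_mono) auto
  finally show ?thesis using False by (simp add: coeff_eq_0 binomial_eq_0)
qed

lemma choose_mult_choose:
  "(n choose k) * (n - k choose s) = (n choose (k + s)) * (k + s choose k)"
proof (cases "k + s \<le> n")
  case True
  then show ?thesis using choose_mult[of k "k + s" n] by simp
next
  case False
  then show ?thesis by (cases "n < k") (auto simp: binomial_eq_0)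
qed

text \<open>The rotation is orthogonal, so at q = 1 + e the Gram matrix is the identity plus e times
  a rank-one matrix with diagonal \<open>a\<close>, \<open>b\<close> and off-diagonal entry c s,
  where (c s)^2 = a b. The index \<open>k\<close> counts the factors of the first power that
  contribute the variable; as many factors of the second power must then contribute their constant
  term.\<close>

lemma shell_prob_pgf_shifted:
  fixes \<theta> e :: real
  assumes "w \<le> n"
  defines "a \<equiv> (1 - cos \<theta>) / 2" and "b \<equiv> (1 + cos \<theta>) / 2"
  shows "(\<Sum>v\<le>n. shell_prob n \<theta> w v * (1 + e) ^ v) =
    (\<Sum>k\<le>w. real ((n - w choose k) * (w choose k)) * (a * b) ^ k * e ^ (2*k)
        * (1 + a * e) ^ (n - w - k) * (1 + b * e) ^ (w - k))"
proof -
  let ?g = "gram (1 + e) (qubit_rot \<theta>)"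
  define c s where "c = cos (\<theta>/2)" and "s = sin (\<theta>/2)"
  have cs: "c\<^sup>2 + s\<^sup>2 = 1" by (simp add: c_def s_def)
  have "cos \<theta> = c\<^sup>2 - s\<^sup>2" using cos_double[of "\<theta>/2"] by (simp add: c_def s_def)
  then have a: "a = s\<^sup>2" and b: "b = c\<^sup>2" using cs by (simp_all add: a_def b_def field_simps)
  have g: "?g False False = 1 + a * e" "?g True True = 1 + b * e"
    "?g False True = e * (c * s)" "?g True False = e * (c * s)"
    using cs by (simp_all add: gram_def qubit_rot_def a b c_def[symmetric] s_def[symmetric] algebra_simps power2_eq_square)
  have "(\<Sum>v\<le>n. shell_prob n \<theta> w v * (1 + e) ^ v) =
      (\<Sum>k\<le>w. real (n - w choose k) * (e * (c * s)) ^ k * (1 + a * e) ^ (n - w - k) *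
        (real (w choose (w - k)) * (1 + b * e) ^ (w - k) * (e * (c * s)) ^ (w - (w - k))))"
    unfolding shell_prob_pgf[OF assms(1)] shell_sum_def coeff_mult coeff_linear_power_all g ..
  also have "\<dots> = (\<Sum>k\<le>w. real ((n - w choose k) * (w choose k)) * (a * b) ^ k * e ^ (2*k)
        * (1 + a * e) ^ (n - w - k) * (1 + b * e) ^ (w - k))"
  proof (intro sum.cong refl)
    fix k assume "k \<in> {..w}"
    then have k: "k \<le> w" by simp
    have "(e * (c * s)) ^ k * (e * (c * s)) ^ k = (a * b) ^ k * e ^ (2 * k)"
      by (simp add: a b power_mult_distrib power2_eq_square mult_2 mult_2_right power_add mult_ac)
    then show "real (n - w choose k) * (e * (c * s)) ^ k * (1 + a * e) ^ (n - w - k) *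
        (real (w choose (w - k)) * (1 + b * e) ^ (w - k) * (e * (c * s)) ^ (w - (w - k)))
      = real ((n - w choose k) * (w choose k)) * (a * b) ^ k * e ^ (2*k)
        * (1 + a * e) ^ (n - w - k) * (1 + b * e) ^ (w - k)"
      using k by (simp add: binomial_symmetric[OF k, symmetric] mult_ac)
  qed
  finally show ?thesis .
qed

text \<open>Since (1 + e)^v has coefficient (v choose l) at e^l, binomial moments are coefficients
  of the shifted generating function. Its \<open>k\<close>-th term starts at e^(2k), so for
  \<open>l < 6\<close> only \<open>k \<le> 2\<close> contributes.\<close>

lemma shell_prob_binomial_moment:
  fixes l :: nat and \<theta> :: real
  assumes "w \<le> n" "l < 6"
  defines "a \<equiv> (1 - cos \<theta>) / 2" and "b \<equiv> (1 + cos \<theta>) / 2"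
  shows "(\<Sum>v\<le>n. shell_prob n \<theta> w v * real (v choose l)) =
    (\<Sum>k\<le>2. if 2*k \<le> l then (a * b) ^ k * (\<Sum>s\<le>l-2*k.
        real ((n - w choose (k + s)) * (k + s choose k)) * a ^ s *
        (real ((w choose (k + (l-2*k-s))) * (k + (l-2*k-s) choose k)) * b ^ (l-2*k-s))) else 0)"
proof -
  define P1 where "P1 = (\<Sum>v\<le>n. smult (shell_prob n \<theta> w v) ([:1, 1:] ^ v))"
  define P2 where "P2 = (\<Sum>k\<le>w. smult (real ((n - w choose k) * (w choose k)) * (a * b) ^ k)
     (monom 1 (2*k) * ([:1, a:] ^ (n - w - k) * [:1, b:] ^ (w - k))))"
  have "poly P1 e = poly P2 e" for e
    using shell_prob_pgf_shifted[OF assms(1), of \<theta> e, folded a_def b_def]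
    by (simp add: P1_def P2_def poly_sum poly_monom poly_power mult_ac)
  then have "P1 = P2" by (simp add: poly_eq_poly_eq_iff[symmetric] fun_eq_iff)
  define T where "T k = (if 2*k \<le> l then real ((n - w choose k) * (w choose k)) * (a * b) ^ k
      * coeff ([:1, a:] ^ (n - w - k) * [:1, b:] ^ (w - k)) (l - 2*k) else 0)" for k
  have "(\<Sum>v\<le>n. shell_prob n \<theta> w v * real (v choose l)) = coeff P1 l"
    by (simp add: P1_def coeff_sum coeff_linear_power_all)
  also have "\<dots> = (\<Sum>k\<le>w. T k)"
    unfolding \<open>P1 = P2\<close> P2_def T_def by (intro trans[OF coeff_sum] sum.cong refl) (simp add: coeff_monom_mult)
  \<comment> \<open>Passing through \<open>max w 2\<close> gives a range independent of
    \<open>w\<close>: terms beyond \<open>w\<close> vanish with their binomials, terms beyond 2 by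
    degree.\<close>
  also have "\<dots> = (\<Sum>k\<le>max w 2. T k)"
    by (rule sum.mono_neutral_left) (auto simp: T_def binomial_eq_0)
  also have "\<dots> = (\<Sum>k\<le>2. T k)"
    using assms(2) by (intro sum.mono_neutral_right) (auto simp: T_def)
  also have "\<dots> = (\<Sum>k\<le>2. if 2*k \<le> l then (a * b) ^ k * (\<Sum>s\<le>l-2*k.
        real ((n - w choose (k + s)) * (k + s choose k)) * a ^ s *
        (real ((w choose (k + (l-2*k-s))) * (k + (l-2*k-s) choose k)) * b ^ (l-2*k-s))) else 0)"
    unfolding T_def coeff_mult coeff_linear_power_all choose_mult_choose[symmetric]
    by (intro sum.cong refl if_cong) (simp add: sum_distrib_left mult_ac)
  finally show ?thesis .
qed

lemma choose_real:
  "real (N choose Suc (Suc 0)) = real N * (real N - 1) / 2"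
  "real (N choose Suc (Suc (Suc 0))) = real N * (real N - 1) * (real N - 2) / 6"
  "real (N choose Suc (Suc (Suc (Suc 0)))) = real N * (real N - 1) * (real N - 2) * (real N - 3) / 24"
proof -
  show 2: "real (N choose Suc (Suc 0)) = real N * (real N - 1) / 2" for N
    by (induction N) (simp_all add: field_simps)
  show 3: "real (N choose Suc (Suc (Suc 0))) = real N * (real N - 1) * (real N - 2) / 6" for N
  proof (induction N)
    case (Suc N)
    show ?case unfolding binomial_Suc_Suc of_nat_add 2 Suc.IH by (simp add: field_simps)
  qed simp
  show "real (N choose Suc (Suc (Suc (Suc 0)))) = real N * (real N - 1) * (real N - 2) * (real N - 3) / 24"
  proof (induction N)
    case (Suc N)
    show ?case unfolding binomial_Suc_Suc of_nat_add 3 Suc.IH by (simp add: field_simps)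
  qed simp
qed

text \<open>The pattern is: \<open>E l\<close> is the sum over p of (l choose p) (N choose p) (M
  choose (l-p)) a^p b^(l-p). Independent bit flips would give the same sum without the factor (l
  choose p).\<close>

lemma shell_prob_binomial_moments:
  fixes n w :: nat and \<theta> :: real
  assumes w: "w \<le> n"
  defines "a \<equiv> (1 - cos \<theta>) / 2" and "b \<equiv> (1 + cos \<theta>) / 2"
    and "N \<equiv> real (n - w)" and "M \<equiv> real w"
    and "E \<equiv> \<lambda>l. \<Sum>v\<le>n. shell_prob n \<theta> w v * real (v choose l)"
  shows "E 0 = 1"
    and "E 1 = N * a + M * b"
    and "E 2 = N * (N - 1) / 2 * a^2 + 2 * N * M * a * b + M * (M - 1) / 2 * b^2"
    and "E 3 = N * (N - 1) * (N - 2) / 6 * a^3 + 3 * N * (N - 1) / 2 * M * a^2 * b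
      + 3 * N * M * (M - 1) / 2 * a * b^2 + M * (M - 1) * (M - 2) / 6 * b^3"
    and "E 4 = N * (N - 1) * (N - 2) * (N - 3) / 24 * a^4 + 4 * N * (N - 1) * (N - 2) / 6 * M * a^3 * b
      + 6 * N * (N - 1) / 2 * M * (M - 1) / 2 * a^2 * b^2
      + 4 * N * M * (M - 1) * (M - 2) / 6 * a * b^3 + M * (M - 1) * (M - 2) * (M - 3) / 24 * b^4"
proof -
  note mom = shell_prob_binomial_moment[OF w, of _ \<theta>, folded a_def b_def]
  show "E 0 = 1" unfolding E_def by (subst mom) simp_all
  show "E 1 = N * a + M * b"
    unfolding E_def by (subst mom) (simp_all add: numeral_eq_Suc N_def M_def)
  show "E 2 = N * (N - 1) / 2 * a^2 + 2 * N * M * a * b + M * (M - 1) / 2 * b^2"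
    unfolding E_def by (subst mom)
      (simp_all add: numeral_eq_Suc choose_real N_def M_def field_simps)
  show "E 3 = N * (N - 1) * (N - 2) / 6 * a^3 + 3 * N * (N - 1) / 2 * M * a^2 * b
      + 3 * N * M * (M - 1) / 2 * a * b^2 + M * (M - 1) * (M - 2) / 6 * b^3"
    unfolding E_def by (subst mom)
      (simp_all add: numeral_eq_Suc choose_real N_def M_def field_simps)
  show "E 4 = N * (N - 1) * (N - 2) * (N - 3) / 24 * a^4 + 4 * N * (N - 1) * (N - 2) / 6 * M * a^3 * b
      + 6 * N * (N - 1) / 2 * M * (M - 1) / 2 * a^2 * b^2
      + 4 * N * M * (M - 1) * (M - 2) / 6 * a * b^3 + M * (M - 1) * (M - 2) * (M - 3) / 24 * b^4"
    unfolding E_def by (subst mom)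
      (simp_all add: numeral_eq_Suc choose_real N_def M_def field_simps)
qed


section \<open>Central moments\<close>

lemma power_choose_expansion:
  fixes v :: nat
  defines "c \<equiv> \<lambda>l. real (v choose l)"
  shows "(real v)^2 = 2 * c 2 + c 1" 
    and "(real v)^3 = 6 * c 3 + 6 * c 2 + c 1"
    and "(real v)^4 = 24 * c 4 + 36 * c 3 + 14 * c 2 + c 1"
  unfolding c_def by (simp_all add: numeral_eq_Suc choose_real field_simps)

text \<open>The left side is the third central moment expressed through binomial moments. Clearing
  denominators makes this and the next lemma pure ring identities.\<close>

lemma third_moment_identity:
  fixes N M a b u :: real
  assumes b: "b = 1 - a" and u: "u = N * a + M * b"
    and E2: "2 * E2 = N * (N - 1) * a^2 + 4 * N * M * a * b + M * (M - 1) * b^2"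
    and E3: "6 * E3 = N * (N - 1) * (N - 2) * a^3 + 9 * N * (N - 1) * M * a^2 * b
      + 9 * N * M * (M - 1) * a * b^2 + M * (M - 1) * (M - 2) * b^3"
  shows "u^3 + (-1 + 3 * u - 3 * u^2) * u + (- 6 + 6 * u) * E2 + (-6) * E3 = - a * b * (b - a) * (N - M)"
proof -
  have "u^3 + (-1 + 3 * u - 3 * u^2) * u + (- 6 + 6 * u) * E2 + (-6) * E3
     = u^3 + (-1 + 3 * u - 3 * u^2) * u + (- 3 + 3 * u) * (2 * E2) - (6 * E3)" by simp
  also have "\<dots> = - a * b * (b - a) * (N - M)" unfolding E2 E3 u b by algebra
  finally show ?thesis .
qed

lemma fourth_moment_identity:
  fixes N M a b u :: real
  assumes b: "b = 1 - a" and u: "u = N * a + M * b"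
    and E2: "2 * E2 = N * (N - 1) * a^2 + 4 * N * M * a * b + M * (M - 1) * b^2"
    and E3: "6 * E3 = N * (N - 1) * (N - 2) * a^3 + 9 * N * (N - 1) * M * a^2 * b
      + 9 * N * M * (M - 1) * a * b^2 + M * (M - 1) * (M - 2) * b^3"
    and E4: "24 * E4 = N * (N - 1) * (N - 2) * (N - 3) * a^4 + 16 * N * (N - 1) * (N - 2) * M * a^3 * b
      + 36 * N * (N - 1) * M * (M - 1) * a^2 * b^2
      + 16 * N * M * (M - 1) * (M - 2) * a * b^3 + M * (M - 1) * (M - 2) * (M - 3) * b^4"
  shows "2 * (u^4 + (1 - 4 * u + 6 * u^2 - 4 * u^3) * u + (14 - 24 * u + 12 * u^2) * E2
      + (36 - 24 * u) * E3 + 24 * E4)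
    = 2 * a * b * (b - a)^2 * (2 * N * M + N + M)
      + (a * b)^2 * (3 * (2 * N * M + N + M)^2 - 2 * (N + M)^2 - 4 * (N + M) + 5 * (N - M)^2)"
proof -
  have "2 * (u^4 + (1 - 4 * u + 6 * u^2 - 4 * u^3) * u + (14 - 24 * u + 12 * u^2) * E2
      + (36 - 24 * u) * E3 + 24 * E4)
    = 2 * u^4 + 2 * (1 - 4 * u + 6 * u^2 - 4 * u^3) * u + (14 - 24 * u + 12 * u^2) * (2 * E2)
      + (12 - 8 * u) * (6 * E3) + 2 * (24 * E4)" by (simp add: algebra_simps)
  also have "\<dots> = 2 * a * b * (b - a)^2 * (2 * N * M + N + M)
      + (a * b)^2 * (3 * (2 * N * M + N + M)^2 - 2 * (N + M)^2 - 4 * (N + M) + 5 * (N - M)^2)"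
    unfolding E2 E3 E4 u b by algebra
  finally show ?thesis .
qed

text \<open>The outcome J - v has mean m C, so its deviation equals u - v with u the mean weight.
  Powers of u - v are expanded in binomials (v choose l), whose expectations are known. The
  hypotheses force J = n/2.\<close>

lemma shell_prob_central_moments:
  fixes n w :: nat and \<theta> J m :: real
  assumes w: "w \<le> n" and N: "real (n - w) = J + m" and M: "real w = J - m"
  defines "C \<equiv> cos \<theta>" and "A \<equiv> J * (J + 1)"
  defines "K \<equiv> \<lambda>l. \<Sum>v\<le>n. shell_prob n \<theta> w v * ((J - real v) - m * C) ^ l"
  shows "K 0 = 1" and "K 1 = 0" and "K 2 = (1 - C^2) * (A - m^2) / 2"
    and "K 3 = - (1 - C^2) * C * m / 2"
    and "K 4 = (1 - C^2) * C^2 * (A - m^2) / 2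
       + (1 - C^2)^2 * (3 * A^2 - 6 * A * m^2 + 3 * m^4 - 2 * A + 5 * m^2) / 8"
proof -
  define E where "E l = (\<Sum>v\<le>n. shell_prob n \<theta> w v * real (v choose l))" for l
  define a b where "a = (1 - C) / 2" and "b = (1 + C) / 2"
  define P Q where "P = J + m" and "Q = J - m"
  define u where "u = P * a + Q * b"
  note E = shell_prob_binomial_moments[OF w, of \<theta>, folded E_def C_def, folded a_def b_def, unfolded N M, folded P_def Q_def]
  have b: "b = 1 - a" by (simp add: a_def b_def field_simps)
  have E2: "2 * E 2 = P * (P - 1) * a^2 + 4 * P * Q * a * b + Q * (Q - 1) * b^2"
    unfolding E by (simp add: field_simps)
  have E3: "6 * E 3 = P * (P - 1) * (P - 2) * a^3 + 9 * P * (P - 1) * Q * a^2 * b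
      + 9 * P * Q * (Q - 1) * a * b^2 + Q * (Q - 1) * (Q - 2) * b^3"
    unfolding E by (simp add: field_simps)
  have E4: "24 * E 4 = P * (P - 1) * (P - 2) * (P - 3) * a^4 + 16 * P * (P - 1) * (P - 2) * Q * a^3 * b
      + 36 * P * (P - 1) * Q * (Q - 1) * a^2 * b^2
      + 16 * P * Q * (Q - 1) * (Q - 2) * a * b^3 + Q * (Q - 1) * (Q - 2) * (Q - 3) * b^4"
    unfolding E by (simp add: field_simps)
  have E01: "E 0 = 1" "E 1 = u" unfolding E u_def by simp_all
  have ab: "a * b = (1 - C^2) / 4" "b - a = C" "P - Q = 2 * m" "P + Q = 2 * J"
    "2 * P * Q + P + Q = 2 * (A - m^2)"
    by (simp_all add: a_def b_def P_def Q_def A_def field_simps power2_eq_square)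
  have lin: "(\<Sum>v\<le>n. shell_prob n \<theta> w v * (c0 + c1 * real (v choose 1) + c2 * real (v choose 2)
      + c3 * real (v choose 3) + c4 * real (v choose 4))) = c0 * E 0 + c1 * E 1 + c2 * E 2 + c3 * E 3 + c4 * E 4"
    for c0 c1 c2 c3 c4
    unfolding E_def by (simp add: distrib_left sum.distrib sum_distrib_left mult_ac)
  have x: "(J - real v) - m * C = u - real v" for v
    by (simp add: u_def a_def b_def P_def Q_def field_simps)
  show "K 0 = 1" using E01(1) by (simp add: K_def E_def)
  have "K 1 = u * E 0 + (-1) * E 1 + 0 * E 2 + 0 * E 3 + 0 * E 4"
    unfolding K_def x lin[symmetric] by (intro sum.cong refl) simp
  then show "K 1 = 0" unfolding E01 by simp
  have "(u - real v)^2 = u^2 + (1 - 2 * u) * real (v choose 1) + 2 * real (v choose 2)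
      + 0 * real (v choose 3) + 0 * real (v choose 4)" for v
    using power_choose_expansion[of v] by (simp add: power2_diff algebra_simps)
  then have "K 2 = u^2 * E 0 + (1 - 2 * u) * E 1 + 2 * E 2 + 0 * E 3 + 0 * E 4"
    unfolding K_def x lin[symmetric] by (intro sum.cong refl) simp
  also have "\<dots> = a * b * (2 * P * Q + P + Q)"
    unfolding E01 E2 u_def b by (simp add: algebra_simps power2_eq_square)
  finally show "K 2 = (1 - C^2) * (A - m^2) / 2" unfolding ab by (simp add: field_simps)
  have "(u - real v)^3 = u^3 + (-1 + 3 * u - 3 * u^2) * real (v choose 1) + (- 6 + 6 * u) * real (v choose 2)
      + (-6) * real (v choose 3) + 0 * real (v choose 4)" for v
  proof -
    have "(u - real v)^3 = u^3 - 3 * u^2 * real v + 3 * u * (real v)^2 - (real v)^3" by algebra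
    then show ?thesis unfolding power_choose_expansion by (simp add: algebra_simps)
  qed
  then have "K 3 = u^3 * E 0 + (-1 + 3 * u - 3 * u^2) * E 1 + (- 6 + 6 * u) * E 2 + (-6) * E 3 + 0 * E 4"
    unfolding K_def x lin[symmetric] by (intro sum.cong refl) simp
  also have "\<dots> = - a * b * (b - a) * (P - Q)"
    using third_moment_identity[OF b u_def E2 E3] unfolding E01 by simp
  also have "\<dots> = - (a * b) * (b - a) * (P - Q)" by simp
  finally show "K 3 = - (1 - C^2) * C * m / 2" unfolding ab by (simp add: field_simps)
  have "(u - real v)^4 = u^4 + (1 - 4 * u + 6 * u^2 - 4 * u^3) * real (v choose 1)
      + (14 - 24 * u + 12 * u^2) * real (v choose 2)
      + (36 - 24 * u) * real (v choose 3) + 24 * real (v choose 4)" for v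
  proof -
    have "(u - real v)^4 = u^4 - 4 * u^3 * real v + 6 * u^2 * (real v)^2 - 4 * u * (real v)^3 + (real v)^4" by algebra
    then show ?thesis unfolding power_choose_expansion by (simp add: algebra_simps)
  qed
  then have "K 4 = u^4 * E 0 + (1 - 4 * u + 6 * u^2 - 4 * u^3) * E 1 + (14 - 24 * u + 12 * u^2) * E 2
      + (36 - 24 * u) * E 3 + 24 * E 4"
    unfolding K_def x lin[symmetric] by (intro sum.cong refl) simp
  then have "2 * K 4 = 2 * (a * b) * (b - a)^2 * (2 * P * Q + P + Q)
      + (a * b)^2 * (3 * (2 * P * Q + P + Q)^2 - 2 * (P + Q)^2 - 4 * (P + Q) + 5 * (P - Q)^2)"
    using fourth_moment_identity[OF b u_def E2 E3 E4] unfolding E01 by (simp add: mult.assoc)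
  also have "3 * (2 * P * Q + P + Q)^2 - 2 * (P + Q)^2 - 4 * (P + Q) + 5 * (P - Q)^2
     = 4 * (3 * A^2 - 6 * A * m^2 + 3 * m^4 - 2 * A + 5 * m^2)"
    unfolding ab A_def by algebra
  finally show "K 4 = (1 - C^2) * C^2 * (A - m^2) / 2
       + (1 - C^2)^2 * (3 * A^2 - 6 * A * m^2 + 3 * m^4 - 2 * A + 5 * m^2) / 8"
    unfolding ab by (simp add: field_simps power2_eq_square)
qed

section \<open>Moments of the measured value of J_z\<close>

lemma sum_meas_prob:
  assumes "m \<in> {- int j..int j}"
  shows "(\<Sum>m'\<in>{- int j..int j}. meas_prob j \<theta> m m' * f m')
    = (\<Sum>v\<le>2*j. shell_prob (2*j) \<theta> (nat (int j - m)) v * f (int j - int v))"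
proof (rule sum.reindex_bij_witness[where i = "\<lambda>v. int j - int v" and j = "\<lambda>m'. nat (int j - m')"])
  fix m' assume m': "m' \<in> {- int j..int j}"
  then show "shell_prob (2*j) \<theta> (nat (int j - m)) (nat (int j - m')) * f (int j - int (nat (int j - m')))
      = meas_prob j \<theta> m m' * f m'"
    using meas_prob_eq_shell_prob[OF assms m'] by simp
qed auto

lemma meas_prob_moments:
  fixes j :: nat and m :: int and \<theta> :: real
  assumes m: "m \<in> {- int j..int j}"
  defines "J \<equiv> real j" and "M \<equiv> real_of_int m" and "C \<equiv> cos \<theta>"
  defines "A \<equiv> J * (J + 1)"
  defines "K \<equiv> \<lambda>l. \<Sum>m'\<in>{- int j..int j}. meas_prob j \<theta> m m' * (real_of_int m' - M * C) ^ l"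
  shows "K 0 = 1" and "K 1 = 0" and "K 2 = (1 - C^2) * (A - M^2) / 2"
    and "K 3 = - (1 - C^2) * C * M / 2"
    and "K 4 = (1 - C^2) * C^2 * (A - M^2) / 2
       + (1 - C^2)^2 * (3 * A^2 - 6 * A * M^2 + 3 * M^4 - 2 * A + 5 * M^2) / 8"
proof -
  let ?w = "nat (int j - m)"
  have w: "?w \<le> 2 * j" "real (2 * j - ?w) = J + M" "real ?w = J - M"
    using m by (auto simp: J_def M_def of_nat_diff nat_le_iff)
  have K: "K l = (\<Sum>v\<le>2*j. shell_prob (2*j) \<theta> ?w v * ((J - real v) - M * C) ^ l)" for l
    unfolding K_def sum_meas_prob[OF m] by (simp add: J_def)
  note k = shell_prob_central_moments[OF w, of \<theta>, folded C_def, folded K, folded A_def]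
  show "K 0 = 1" and "K 1 = 0" and "K 2 = (1 - C^2) * (A - M^2) / 2"
    and "K 3 = - (1 - C^2) * C * M / 2"
    and "K 4 = (1 - C^2) * C^2 * (A - M^2) / 2
       + (1 - C^2)^2 * (3 * A^2 - 6 * A * M^2 + 3 * M^4 - 2 * A + 5 * M^2) / 8"
    by (fact k)+
qed

lemma meas_prob_nonneg: "meas_prob j \<theta> m m' \<ge> 0"
  by (simp add: meas_prob_def)

lemma sum_meas_prob_1:
  assumes "m \<in> {- int j..int j}"
  shows "(\<Sum>m'\<in>{- int j..int j}. meas_prob j \<theta> m m') = 1"
  using meas_prob_moments(1)[OF assms, of \<theta>] by simp

lemma second_moment:
  assumes m: "m \<in> {- int j..int j}"
  shows "(\<Sum>m'\<in>{- int j..int j}. meas_prob j \<theta> m m' * (real_of_int m')\<^sup>2)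
    = (real_of_int m * cos \<theta>)\<^sup>2 + (1 - (cos \<theta>)\<^sup>2) * (real j * (real j + 1) - (real_of_int m)\<^sup>2) / 2"
proof -
  let ?c = "real_of_int m * cos \<theta>" and ?p = "meas_prob j \<theta> m"
  have "(\<Sum>m'\<in>{- int j..int j}. ?p m' * (real_of_int m')\<^sup>2)
     = (\<Sum>m'\<in>{- int j..int j}. ?p m' * (real_of_int m' - ?c) ^ 2)
      + 2 * ?c * (\<Sum>m'\<in>{- int j..int j}. ?p m' * (real_of_int m' - ?c) ^ 1)
      + ?c^2 * (\<Sum>m'\<in>{- int j..int j}. ?p m' * (real_of_int m' - ?c) ^ 0)"
    unfolding sum_distrib_left sum.distrib[symmetric]
    by (intro sum.cong refl) (simp add: power2_eq_square algebra_simps)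
  then show ?thesis
    unfolding meas_prob_moments[OF m] by simp
qed

lemma cos_theta:
  assumes "j \<ge> 1" "m \<in> {- int j..int j}"
  shows "(cos (theta j m))\<^sup>2 = 1 - (real_of_int m / real j)\<^sup>2" "cos (theta j m) \<ge> 0"
proof -
  have le: "-1 \<le> real_of_int m / real j" "real_of_int m / real j \<le> 1"
    using assms by (auto simp: field_simps)
  then have c: "cos (theta j m) = sqrt (1 - (real_of_int m / real j)\<^sup>2)"
    unfolding theta_def by (intro cos_arcsin) auto
  have "(real_of_int m / real j)\<^sup>2 \<le> 1"
    using le by (simp add: abs_square_le_1 abs_le_iff)
  with c show "(cos (theta j m))\<^sup>2 = 1 - (real_of_int m / real j)\<^sup>2" "cos (theta j m) \<ge> 0" by simp_all
qed

section \<open>Expectation of a quartic in the relative change of m\<close>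

definition quartic :: "real \<Rightarrow> real \<Rightarrow> real \<Rightarrow> real \<Rightarrow> real \<Rightarrow> real \<Rightarrow> real" where
  "quartic a0 a1 a2 a3 a4 u = a0 + a1 * u + a2 * u^2 + a3 * u^3 + a4 * u^4"

text \<open>The rotation angle satisfies 1 - C^2 = m^2 / j^2, so dividing the central moments by
  powers of m leaves values near 1/2, 0 and 3/8 + 1 / (2 m^2). The ratio m' / m has mean C, and
  moving the center to 1 costs O(1/j). The signs of \<open>a1\<close> and \<open>a2\<close> allow
  the first two moments to enter as one-sided bounds without error.\<close>

lemma expectation_quartic:
  fixes j :: nat and m :: int
  assumes j: "j \<ge> 2" and m0: "m \<noteq> 0" and mj: "(real_of_int m)\<^sup>2 \<le> real j"
    and a: "a1 \<ge> 0" "a2 \<le> 0" "\<bar>a3\<bar> \<le> 1" "0 \<le> a4" "a4 \<le> 1"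
  shows "(\<Sum>m'\<in>{- int j..int j}. meas_prob j (theta j m) m m' *
      quartic a0 a1 a2 a3 a4 ((real_of_int m' - real_of_int m) / real_of_int m))
    \<le> a0 + a2 / 2 + a4 * (3/8 + 1 / (2 * (real_of_int m)\<^sup>2)) + 20 / real j"
proof -
  define J M C A where "J = real j" and "M = real_of_int m" and "C = cos (theta j m)"
    and "A = J * (J + 1)"
  define p where "p = meas_prob j (theta j m) m"
  define \<delta> where "\<delta> = 1 - C"
  define K where "K l = (\<Sum>m'\<in>{- int j..int j}. p m' * (real_of_int m' - M * C) ^ l)" for l
  have J: "J \<ge> 2" using j by (simp add: J_def)
  have M0: "M \<noteq> 0" using m0 by (simp add: M_def)
  have "1 \<le> m\<^sup>2" using m0 by (metis int_one_le_iff_zero_less zero_less_power2)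
  then have M1: "M\<^sup>2 \<ge> 1"
    unfolding M_def by (metis of_int_1_le_iff of_int_power)
  have MJ: "M\<^sup>2 \<le> J" using mj by (simp add: M_def J_def)
  have "M\<^sup>2 \<le> J\<^sup>2" using MJ J self_le_power[of J 2] by linarith
  then have "\<bar>M\<bar> \<le> J" using J by (simp add: abs_le_square_iff[symmetric])
  then have m: "m \<in> {- int j..int j}" unfolding M_def J_def by auto
  have C2: "C\<^sup>2 = 1 - (M / J)\<^sup>2" and C0: "C \<ge> 0"
    using cos_theta[OF _ m] j by (auto simp: C_def M_def J_def)
  have S: "1 - C^2 = M^2 / J^2" using C2 by (simp add: power_divide)
  have C21: "C\<^sup>2 \<le> 1" using C2 by simp
  have C1: "C \<le> 1" using C21 C0 by (simp add: abs_square_le_1)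
  have SJ: "M^2 / J^2 \<le> 1 / J"
    using MJ J by (simp add: power2_eq_square field_simps)
  have \<delta>0: "\<delta> \<ge> 0" using C1 by (simp add: \<delta>_def)
  have "\<delta> \<le> 1 - C^2" using C0 C1 by (simp add: \<delta>_def power2_eq_square mult_left_le)
  then have \<delta>J: "\<delta> \<le> 1 / J" using S SJ by simp
  have \<delta>1: "\<delta> \<le> 1" using C0 by (simp add: \<delta>_def)
  note mom = meas_prob_moments[OF m, of "theta j m", folded p_def C_def M_def J_def, folded K_def A_def, unfolded S]
  define k2 k3 k4 where "k2 = K 2 / M^2" and "k3 = K 3 / M^3" and "k4 = K 4 / M^4"
  have k2: "k2 = (A - M^2) / (2 * J^2)"
  proof -
    have "P / Q * X / 2 / P = X / (2 * Q)" if "P \<noteq> 0" for P Q X :: real using that by simp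
    then show ?thesis unfolding k2_def mom using M0 by simp
  qed
  have k3: "k3 = - C / (2 * J^2)"
    unfolding k3_def mom using M0 J by (simp add: field_simps power2_eq_square power3_eq_cube)
  have k4: "k4 = C^2 * k2 / M^2 + (3 * A^2 - 6 * A * M^2 + 3 * M^4 - 2 * A + 5 * M^2) / (8 * J^4)"
    unfolding k4_def mom k2 using M0 J by (simp add: field_simps power2_eq_square power4_eq_xxxx)
  have k2l: "k2 \<ge> 1/2" unfolding k2 A_def using MJ J by (simp add: field_simps power2_eq_square)
  have k2u: "k2 \<le> 1/2 + 1 / (2 * J)"
    unfolding k2 A_def using M1 J by (simp add: field_simps power2_eq_square)
  have "1 / (2 * J) \<le> 1/2" using J by simp
  with k2u have k21: "k2 \<le> 1" by linarith
  have "C \<le> 2 * J" using C1 J by linarith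
  then have k3b: "\<bar>k3\<bar> \<le> 1 / J" unfolding k3 using C0 J by (simp add: field_simps power2_eq_square)
  have k4u: "k4 \<le> 3/8 + 1 / (2 * M^2) + 3 / J"
  proof -
    have "C^2 * k2 \<le> 1 * k2" using C21 k2l by (intro mult_right_mono) auto
    then have "C^2 * k2 / M^2 \<le> k2 / M^2" using M1 by (intro divide_right_mono) auto
    also have "\<dots> \<le> (1/2 + 1 / (2 * J)) / M^2" using k2u M1 by (intro divide_right_mono) auto
    also have "\<dots> = 1 / (2 * M^2) + 1 / (2 * J) / M^2" by (simp add: add_divide_distrib)
    also have "\<dots> \<le> 1 / (2 * M^2) + 1 / (2 * J)"
      using M1 J by (simp add: divide_le_eq field_simps)
    finally have 1: "C^2 * k2 / M^2 \<le> 1 / (2 * M^2) + 1 / (2 * J)" .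
    \<comment> \<open>Apart from \<open>3 * A^2\<close> the terms of the numerator add up to at most
      0, so 3/8 (1 + 1/J)^2 bounds the quotient.\<close>
    have "M^2 * M^2 \<le> A * M^2"
      using MJ J by (intro mult_right_mono) (auto simp: A_def power2_eq_square field_simps intro: order_trans)
    moreover have "5 * M^2 \<le> 2 * A" 
    proof -
      have "5 * J \<le> 2 * (J * (J + 1)) + J" using J mult_right_mono[of 2 J J] by (simp add: algebra_simps)
      moreover have "J * (J + 1) \<ge> J * 3" using J by (intro mult_left_mono) auto
      ultimately show ?thesis using MJ J unfolding A_def by linarith
    qed
    moreover have "0 \<le> A * M^2" unfolding A_def using J by simp
    ultimately have "3 * A^2 - 6 * A * M^2 + 3 * M^4 - 2 * A + 5 * M^2 \<le> 3 * A^2"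
      by (simp add: power2_eq_square power4_eq_xxxx mult.assoc)
    then have "(3 * A^2 - 6 * A * M^2 + 3 * M^4 - 2 * A + 5 * M^2) / (8 * J^4) \<le> 3 * A^2 / (8 * J^4)"
      by (intro divide_right_mono) auto
    also have "\<dots> = 3/8 * (1 + 2 / J + 1 / J * (1 / J))"
      unfolding A_def using J by (simp add: field_simps power2_eq_square power4_eq_xxxx)
    also have "\<dots> \<le> 3/8 * (1 + 2 / J + 1 * (1 / J))"
      using J by (intro mult_left_mono add_left_mono mult_right_mono) auto
    finally have 2: "(3 * A^2 - 6 * A * M^2 + 3 * M^4 - 2 * A + 5 * M^2) / (8 * J^4) \<le> 3/8 * (1 + 2 / J + 1 * (1 / J))" .
    have "1 / (2 * J) + 3/8 * (1 + 2 / J + 1 * (1 / J)) \<le> 3/8 + 3 / J"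
      using J by (simp add: field_simps)
    then have "(1 / (2 * M^2) + 1 / (2 * J)) + 3/8 * (1 + 2 / J + 1 * (1 / J)) \<le> 3/8 + 1 / (2 * M^2) + 3 / J"
      by simp
    with add_mono[OF 1 2] show ?thesis unfolding k4 by (rule order_trans)
  qed
  define E where "E l = (\<Sum>m'\<in>{- int j..int j}. p m' * ((real_of_int m' - M) / M) ^ l)" for l
  have u: "(real_of_int m' - M) / M = (real_of_int m' - M * C) / M - \<delta>" for m'
    using M0 by (simp add: \<delta>_def field_simps)
  have E1: "E 1 = - \<delta>"
  proof -
    have "E 1 = K 1 / M - \<delta> * K 0"
      unfolding E_def K_def u sum_divide_distrib sum_distrib_left sum_subtractf[symmetric]
      by (intro sum.cong refl) (simp add: algebra_simps)
    then show ?thesis unfolding mom by simp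
  qed
  have E2: "E 2 = k2 + \<delta>^2"
  proof -
    have "E 2 = K 2 / M^2 - 2 * \<delta> / M * K 1 + \<delta>^2 * K 0"
      unfolding E_def K_def u sum_divide_distrib sum_distrib_left sum_subtractf[symmetric] sum.distrib[symmetric]
      using M0 by (intro sum.cong refl) (simp add: power2_eq_square field_simps)
    then show ?thesis unfolding k2_def mom(1,2) by simp
  qed
  have E3: "E 3 = k3 - 3 * \<delta> * k2 - \<delta>^3"
  proof -
    have "E 3 = K 3 / M^3 - 3 * \<delta> / M^2 * K 2 + 3 * \<delta>^2 / M * K 1 - \<delta>^3 * K 0"
      unfolding E_def K_def u sum_divide_distrib sum_distrib_left sum_subtractf[symmetric] sum.distrib[symmetric]
      using M0 by (intro sum.cong refl) (simp add: power2_eq_square power3_eq_cube field_simps)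
    then show ?thesis unfolding k2_def k3_def mom(1,2) by simp
  qed
  have E4: "E 4 = k4 - 4 * \<delta> * k3 + 6 * \<delta>^2 * k2 + \<delta>^4"
  proof -
    have "E 4 = K 4 / M^4 - 4 * \<delta> / M^3 * K 3 + 6 * \<delta>^2 / M^2 * K 2 - 4 * \<delta>^3 / M * K 1 + \<delta>^4 * K 0"
      unfolding E_def K_def u sum_divide_distrib sum_distrib_left sum_subtractf[symmetric] sum.distrib[symmetric]
      using M0 by (intro sum.cong refl) (simp add: power2_eq_square power3_eq_cube power4_eq_xxxx field_simps)
    then show ?thesis unfolding k2_def k3_def k4_def mom(1,2) by simp
  qed
  have E0: "E 0 = 1" using mom(1) by (simp add: E_def K_def)
  have \<delta>p: "\<delta>^2 \<le> 1/J" "\<delta>^3 \<le> 1/J" "\<delta>^4 \<le> 1/J"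
  proof -
    have "\<delta> ^ k \<le> 1 / J" if "k \<ge> 1" for k
      using power_decreasing[OF that \<delta>0 \<delta>1] \<delta>J by simp
    then show "\<delta>^2 \<le> 1/J" "\<delta>^3 \<le> 1/J" "\<delta>^4 \<le> 1/J" by simp_all
  qed
  have E3b: "\<bar>E 3\<bar> \<le> 5 / J"
  proof -
    have "\<delta> * k2 \<le> 1 / J * 1" using \<delta>0 \<delta>J k21 k2l J by (intro mult_mono) auto
    moreover have "0 \<le> \<delta> * k2" "0 \<le> \<delta>^3" using \<delta>0 k2l by auto
    moreover have "5 / J = 5 * (1 / J)" "3 * \<delta> * k2 = 3 * (\<delta> * k2)" "0 \<le> 1 / J" using J by simp_all
    ultimately show ?thesis unfolding E3 using k3b \<delta>p(2) unfolding abs_le_iff by linarith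
  qed
  \<comment> \<open>The four terms of \<open>E 4\<close> cost 3, 4, 6 and 1 times 1/J, rounded up to
    15/J. With the 5/J for \<open>E 3\<close> this makes the 20/J of the statement.\<close>
  have E4b: "E 4 \<le> 3/8 + 1 / (2 * M^2) + 15 / J"
  proof -
    have "\<bar>\<delta> * k3\<bar> \<le> 1 * (1/J)" unfolding abs_mult using \<delta>0 \<delta>1 k3b by (intro mult_mono) auto
    moreover have "\<delta>^2 * k2 \<le> 1 / J * 1" using \<delta>p k21 k2l J by (intro mult_mono) auto
    ultimately show ?thesis unfolding E4 using k4u \<delta>p(3) by (simp add: abs_le_iff)
  qed
  have "(\<Sum>m'\<in>{- int j..int j}. p m' * quartic a0 a1 a2 a3 a4 ((real_of_int m' - M) / M))
     = a0 * E 0 + a1 * E 1 + a2 * E 2 + a3 * E 3 + a4 * E 4"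
    unfolding E_def quartic_def sum_distrib_left sum.distrib[symmetric]
    by (intro sum.cong refl) (simp add: distrib_left mult_ac)
  also have "\<dots> \<le> a0 + 0 + a2 * (1/2) + 5 / J + a4 * (3/8 + 1 / (2 * M^2)) + 15 / J"
  proof -
    have "a1 * E 1 \<le> 0" unfolding E1 using a(1) \<delta>0 by simp
    moreover have "a2 * E 2 \<le> a2 * (1/2)"
      using a(2) k2l unfolding E2 by (intro mult_left_mono_neg) (auto intro: order_trans)
    moreover have "a3 * E 3 \<le> 5 / J"
    proof -
      have "\<bar>a3 * E 3\<bar> \<le> 1 * (5 / J)" unfolding abs_mult using a(3) E3b by (intro mult_mono) auto
      then show ?thesis by simp
    qed
    moreover have "a4 * E 4 \<le> a4 * (3/8 + 1 / (2 * M^2)) + 15 / J"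
    proof -
      have "a4 * E 4 \<le> a4 * (3/8 + 1 / (2 * M^2) + 15 / J)" using E4b a(4) by (rule mult_left_mono)
      moreover have "a4 * (15 / J) \<le> 1 * (15 / J)" using a(5) J by (intro mult_right_mono) auto
      ultimately show ?thesis by (simp add: algebra_simps)
    qed
    ultimately show ?thesis unfolding E0 by simp
  qed
  also have "\<dots> = a0 + a2 / 2 + a4 * (3/8 + 1 / (2 * M^2)) + 20 / J" by (simp add: field_simps)
  finally show ?thesis by (simp add: p_def M_def J_def)
qed

section \<open>Contraction of the square root\<close>

text \<open>The coefficients below come from \<open>quartic (s\<^sup>2 - 1) - s\<close> having double zeros at
  \<open>s = 4/5\<close> and \<open>s = 7/5\<close>.\<close>

definition sqrt_majorant :: "real \<Rightarrow> real" where
  "sqrt_majorant = quartic (92302400/90635776) (50914000/90635776) (-16471375/90635776)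
     (-10168750/90635776) (11640625/90635776)"

text \<open>With s = sqrt (1 + u), the difference on the nonnegative side is (5 s - 4)^2 (5 s - 7)^2
  times a cofactor with positive coefficients. On the negative side there is room to replace the
  root by a line first.\<close>

lemma sqrt_abs_le_sqrt_majorant: "sqrt \<bar>1 + u\<bar> \<le> sqrt_majorant u"
proof (cases "1 + u \<ge> 0")
  case True
  define s where "s = sqrt (1 + u)"
  have s: "s \<ge> 0" and u: "u = s^2 - 1" using True by (simp_all add: s_def)
  have "90635776 * (sqrt_majorant u - s) = (25 * s^2 - 55 * s + 28)^2
      * (59600 + 118536 * s + 137945 * s^2 + 81950 * s^3 + 18625 * s^4)"
    unfolding sqrt_majorant_def quartic_def u by (simp add: field_simps) algebra
  also have "\<dots> \<ge> 0" using s by (intro mult_nonneg_nonneg add_nonneg_nonneg) auto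
  finally have "s \<le> sqrt_majorant u" by simp
  then show ?thesis using True by (simp add: s_def)
next
  case False
  define x where "x = - 1 - u"
  have x: "x > 0" and u: "u = - 1 - x" using False by (simp_all add: x_def)
  \<comment> \<open>The tangent of the square root at x = 9/25.\<close>
  have "(sqrt x - 3/5)^2 \<ge> 0" by simp
  then have "sqrt x \<le> 5/6 * x + 3/10" using x by (simp add: power2_diff power_divide field_simps)
  also have "\<dots> \<le> sqrt_majorant u"
  proof -
    have q: "90635776 * (sqrt_majorant u - (5/6 * x + 3/10)) =
      11640625 * x^4 + 56731250 * x^3 + 83878625 * x^2 - (6788000 + 90635776 * 5/6) * x + (46726400 - 90635776 * 3 / 10)"
      unfolding sqrt_majorant_def quartic_def u by (simp add: field_simps) algebra
    \<comment> \<open>The cube and the square are bounded below by their tangents at 9/20 and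
      29/100. What then remains is linear in \<open>x\<close> with positive coefficients.\<close>
    have "0 \<le> (x - 9/20)^2 * (x + 9/10)" using x by simp
    then have "x^3 \<ge> 243/400 * x - 729/4000" by (simp add: power2_eq_square power3_eq_cube field_simps)
    moreover have "0 \<le> (x - 29/100)^2" by simp
    then have "x^2 \<ge> 58/100 * x - 841/10000" by (simp add: power2_eq_square algebra_simps)
    moreover have "0 \<le> x^4" by simp
    ultimately have "0 \<le> 11640625 * x^4 + 56731250 * (x^3 - (243/400 * x - 729/4000))
        + 83878625 * (x^2 - (58/100 * x - 841/10000))"
      by (intro add_nonneg_nonneg) auto
    also have "\<dots> \<le> 90635776 * (sqrt_majorant u - (5/6 * x + 3/10))" unfolding q using x by (simp add: field_simps)
    finally have "90635776 * (sqrt_majorant u - (5/6 * x + 3/10)) \<ge> 0" .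
    then show ?thesis by simp
  qed
  finally show ?thesis using x by (simp add: u)
qed

text \<open>For \<open>\<bar>m\<bar> = 1\<close> the fourth central moment is \<open>7/8\<close>, too large for any
  quartic majorant of the square root on all reals; here only integer points matter.\<close>

definition sqrt_majorant_int :: "real \<Rightarrow> real" where
  "sqrt_majorant_int = quartic (102/100) (88/100) (-42/100) (-175/1000) (13/100)"

lemma sqrt_abs_le_sqrt_majorant_int:
  fixes k :: int
  shows "sqrt \<bar>real_of_int k\<bar> \<le> sqrt_majorant_int (real_of_int k - 1)"
proof -
  have sq: "sqrt y \<le> c" if "y \<le> c^2" "c \<ge> 0" for y c :: real
    using that by (simp add: real_le_lsqrt)
  \<comment> \<open>Points near the origin are evaluated directly. Further out |k| replaces its
    root, and the difference is a polynomial with positive coefficients in the distance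
    \<open>z\<close> from 4 or from -2.\<close>
  consider "k = -1" | "k = 0" | "k = 1" | "k = 2" | "k = 3" | "k \<ge> 4" | "k \<le> -2" by linarith
  then show ?thesis
  proof cases
    case 4
    have "sqrt 2 \<le> 142/100" by (rule sq) (simp_all add: power2_eq_square)
    with 4 show ?thesis by (simp add: sqrt_majorant_int_def quartic_def)
  next
    case 5
    have "sqrt 3 \<le> 174/100" by (rule sq) (simp_all add: power2_eq_square)
    with 5 show ?thesis by (simp add: sqrt_majorant_int_def quartic_def)
  next
    case 6
    define z where "z = real_of_int k - 4"
    have z: "z \<ge> 0" and k: "real_of_int k = z + 4" using 6 by (simp_all add: z_def)
    have "sqrt \<bar>real_of_int k\<bar> \<le> z + 4" using z unfolding k by (intro sq) (auto simp: power2_eq_square algebra_simps)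
    also have "\<dots> \<le> (z + 4) + (337/200 + 267/40 * z + 201/40 * z^2 + 277/200 * z^3 + 13/100 * z^4)"
    proof -
      have "0 \<le> 337/200 + 267/40 * z + 201/40 * z^2 + 277/200 * z^3 + 13/100 * z^4"
        using z by (intro add_nonneg_nonneg mult_nonneg_nonneg) auto
      then show ?thesis by linarith
    qed
    also have "\<dots> = sqrt_majorant_int (real_of_int k - 1)"
      unfolding sqrt_majorant_int_def quartic_def k by (simp add: field_simps) algebra
    finally show ?thesis .
  next
    case 7
    define z where "z = - 2 - real_of_int k"
    have z: "z \<ge> 0" and k: "real_of_int k = - 2 - z" using 7 by (simp_all add: z_def)
    have k': "real_of_int k - 1 = - (z + 3)" using k by simp
    have "sqrt \<bar>real_of_int k\<bar> \<le> z + 2" using z unfolding k by (intro sq) (auto simp: power2_eq_square algebra_simps)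
    also have "\<dots> \<le> (z + 2) + (1571/200 + 2873/200 * z + 327/40 * z^2 + 347/200 * z^3 + 13/100 * z^4)"
    proof -
      have "0 \<le> 1571/200 + 2873/200 * z + 327/40 * z^2 + 347/200 * z^3 + 13/100 * z^4"
        using z by (intro add_nonneg_nonneg mult_nonneg_nonneg) auto
      then show ?thesis by linarith
    qed
    also have "\<dots> = sqrt_majorant_int (real_of_int k - 1)"
      unfolding sqrt_majorant_int_def quartic_def k' by (simp add: field_simps) algebra
    finally show ?thesis .
  qed (simp_all add: sqrt_majorant_int_def quartic_def)
qed

text \<open>After division by |m| a majorant is applied to the ratio m' / m. For
  \<open>j \<ge> 10000\<close> the error 20/j is at most 0.002. The expectation of the majorant is
  then below 0.93 if |m| = 1, and below 0.994 if |m| \<ge> 2, where 1 / (2 m^2) \<le> 1/8.\<close>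

lemma expectation_sqrt:
  fixes j :: nat and m :: int
  assumes j: "j \<ge> 10000" and m0: "m \<noteq> 0" and mj: "(real_of_int m)\<^sup>2 \<le> real j"
  shows "(\<Sum>m'\<in>{- int j..int j}. meas_prob j (theta j m) m m' * sqrt \<bar>real_of_int m'\<bar>)
    \<le> 995/1000 * sqrt \<bar>real_of_int m\<bar>"
proof -
  define M where "M = real_of_int m"
  have M0: "M \<noteq> 0" using m0 by (simp add: M_def)
  have "\<exists>Q. (\<forall>m'. sqrt \<bar>real_of_int m' / M\<bar> \<le> Q ((real_of_int m' - M) / M)) \<and>
    (\<Sum>m'\<in>{- int j..int j}. meas_prob j (theta j m) m m' * Q ((real_of_int m' - M) / M)) \<le> 995/1000"
  proof (cases "\<bar>m\<bar> = 1")
    case True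
    have M2: "M^2 = 1" using True by (auto simp: M_def abs_if split: if_splits)
    have "sqrt \<bar>real_of_int m' / M\<bar> \<le> sqrt_majorant_int ((real_of_int m' - M) / M)" for m'
    proof -
      \<comment> \<open>As m is 1 or -1, division by m is multiplication, so the ratio is an
        integer.\<close>
      have "real_of_int m' / M = real_of_int (m' * m)" "(real_of_int m' - M) / M = real_of_int (m' * m) - 1"
        using M2 M0 by (simp_all add: field_simps power2_eq_square M_def[symmetric])
      then show ?thesis using sqrt_abs_le_sqrt_majorant_int[of "m' * m"] by simp
    qed
    moreover have "(\<Sum>m'\<in>{- int j..int j}. meas_prob j (theta j m) m m' * sqrt_majorant_int ((real_of_int m' - M) / M)) \<le> 995/1000"
    proof -
      have "(\<Sum>m'\<in>{- int j..int j}. meas_prob j (theta j m) m m' * sqrt_majorant_int ((real_of_int m' - M) / M))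
         \<le> 102/100 + (-42/100) / 2 + 13/100 * (3/8 + 1 / (2 * M^2)) + 20 / real j"
        unfolding sqrt_majorant_int_def M_def using j m0 mj by (intro expectation_quartic) auto
      also have "20 / real j \<le> 20 / 10000" using j by (intro divide_left_mono) auto
      finally show ?thesis unfolding M2 by simp
    qed
    ultimately show ?thesis by blast
  next
    case False
    then have "2 \<le> \<bar>M\<bar>" using m0 by (simp add: M_def flip: of_int_abs)
    then have M2: "4 \<le> M^2" using power_mono[of 2 "\<bar>M\<bar>" 2] by simp
    have "sqrt \<bar>real_of_int m' / M\<bar> \<le> sqrt_majorant ((real_of_int m' - M) / M)" for m'
      using sqrt_abs_le_sqrt_majorant[of "(real_of_int m' - M) / M"] M0 by (simp add: diff_divide_distrib)
    moreover have "(\<Sum>m'\<in>{- int j..int j}. meas_prob j (theta j m) m m' * sqrt_majorant ((real_of_int m' - M) / M)) \<le> 995/1000"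
    proof -
      have "(\<Sum>m'\<in>{- int j..int j}. meas_prob j (theta j m) m m' * sqrt_majorant ((real_of_int m' - M) / M))
         \<le> 92302400/90635776 + (-16471375/90635776) / 2 + 11640625/90635776 * (3/8 + 1 / (2 * M^2)) + 20 / real j"
        unfolding sqrt_majorant_def M_def using j m0 mj by (intro expectation_quartic) auto
      also have "20 / real j \<le> 20 / 10000" using j by (intro divide_left_mono) auto
      also have "1 / (2 * M^2) \<le> 1 / 8" using M2 by (intro divide_left_mono) auto
      finally show ?thesis by simp
    qed
    ultimately show ?thesis by blast
  qed
  then obtain Q where Q: "\<And>m'. sqrt \<bar>real_of_int m' / M\<bar> \<le> Q ((real_of_int m' - M) / M)"
    and EQ: "(\<Sum>m'\<in>{- int j..int j}. meas_prob j (theta j m) m m' * Q ((real_of_int m' - M) / M)) \<le> 995/1000"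
    by blast
  have "(\<Sum>m'\<in>{- int j..int j}. meas_prob j (theta j m) m m' * sqrt \<bar>real_of_int m'\<bar>)
    \<le> (\<Sum>m'\<in>{- int j..int j}. meas_prob j (theta j m) m m' * (sqrt \<bar>M\<bar> * Q ((real_of_int m' - M) / M)))"
  proof (intro sum_mono mult_left_mono meas_prob_nonneg)
    fix m'
    have "sqrt \<bar>real_of_int m'\<bar> = sqrt \<bar>M\<bar> * sqrt \<bar>real_of_int m' / M\<bar>"
      using M0 by (simp add: real_sqrt_mult[symmetric] abs_divide)
    then show "sqrt \<bar>real_of_int m'\<bar> \<le> sqrt \<bar>M\<bar> * Q ((real_of_int m' - M) / M)"
      using Q by (simp add: mult_left_mono)
  qed
  also have "\<dots> = sqrt \<bar>M\<bar> * (\<Sum>m'\<in>{- int j..int j}. meas_prob j (theta j m) m m' * Q ((real_of_int m' - M) / M))"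
    by (simp add: sum_distrib_left mult_ac)
  also have "\<dots> \<le> sqrt \<bar>M\<bar> * (995/1000)" using EQ by (intro mult_left_mono) auto
  finally show ?thesis by (simp add: M_def mult.commute)
qed

section \<open>The Markov chain\<close>

definition reset :: "nat \<Rightarrow> int \<Rightarrow> int" where
  "reset j m = (if real_of_int \<bar>m\<bar> > sqrt (real j) then int j else m)"

section \<open>Reset rule and live states\<close>

lemma reset_range: "m \<in> {- int j..int j} \<Longrightarrow> reset j m \<in> {- int j..int j}"
  by (simp add: reset_def)

text \<open>Contains every value with which an iteration starts with positive probability: the reset
  rule sends all other nonzero outcomes to j.\<close>

definition live :: "nat \<Rightarrow> int set" where
  "live j = {m \<in> {- int j..int j} - {0}. m = int j \<or> (real_of_int m)\<^sup>2 \<le> real j}"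

lemma reset_live:
  assumes "j \<ge> 1" "m \<in> {- int j..int j}" "reset j m \<noteq> 0"
  shows "reset j m \<in> live j"
proof (cases "real_of_int \<bar>m\<bar> > sqrt (real j)")
  case True
  then show ?thesis using assms by (auto simp: live_def reset_def)
next
  case False
  then have "\<bar>real_of_int m\<bar>\<^sup>2 \<le> (sqrt (real j))\<^sup>2" by (intro power_mono) auto
  then show ?thesis using False assms by (auto simp: live_def reset_def)
qed

definition expected_next :: "nat \<Rightarrow> (int \<Rightarrow> real) \<Rightarrow> int \<Rightarrow> real" where
  "expected_next j V m = (\<Sum>m'\<in>{- int j..int j}. meas_prob j (theta j m) m m' * V (reset j m'))"

text \<open>Outcomes are regrouped by their value after the reset. With \<open>V 0 = 0\<close> a
  terminated run contributes nothing.\<close>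

lemma sum_step_prob:
  assumes V0: "V 0 = 0"
  shows "(\<Sum>m''\<in>{- int j..int j} - {0}. step_prob j m m'' * V m'') = expected_next j V m"
proof -
  let ?I = "{- int j..int j}" and ?p = "meas_prob j (theta j m) m"
  have "(\<Sum>m''\<in>?I - {0}. step_prob j m m'' * V m'') = (\<Sum>m''\<in>?I. step_prob j m m'' * V m'')"
    by (rule sum.mono_neutral_left) (auto simp: V0)
  also have "\<dots> = (\<Sum>m''\<in>?I. \<Sum>m'\<in>?I. if reset j m' = m'' then ?p m' * V m'' else 0)"
    unfolding step_prob_def reset_def sum_distrib_right by (intro sum.cong refl) simp
  also have "\<dots> = (\<Sum>m'\<in>?I. \<Sum>m''\<in>?I. if reset j m' = m'' then ?p m' * V m'' else 0)"
    by (rule sum.swap)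
  also have "\<dots> = expected_next j V m"
    unfolding expected_next_def by (intro sum.cong refl) (use reset_range[of _ j] in \<open>simp add: sum.delta'\<close>)
  finally show ?thesis .
qed

section \<open>Distribution after t iterations and drift bounds\<close>

lemma run_nonneg: "run j t m \<ge> 0"
proof (induction t arbitrary: m)
  case (Suc t)
  have "step_prob j a b \<ge> 0" for a b
    unfolding step_prob_def by (intro sum_nonneg) (simp add: meas_prob_nonneg)
  with Suc show ?case by (auto intro!: sum_nonneg mult_nonneg_nonneg)
qed simp

lemma run_live:
  assumes "j \<ge> 1" "m \<in> {- int j..int j} - {0}" "run j t m \<noteq> 0"
  shows "m \<in> live j"
proof (cases t)
  case 0
  then show ?thesis using assms by (auto simp: live_def split: if_splits)
next
  case (Suc t')
  then have "(\<Sum>k\<in>{- int j..int j} - {0}. run j t' k * step_prob j k m) \<noteq> 0" using assms(3) by simp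
  then obtain k where "run j t' k * step_prob j k m \<noteq> 0" by (rule sum.not_neutral_contains_not_neutral)
  then have "step_prob j k m \<noteq> 0" by simp
  then obtain m' where "m' \<in> {- int j..int j}" "reset j m' = m"
    unfolding step_prob_def reset_def
    by (auto elim!: sum.not_neutral_contains_not_neutral split: if_splits)
  then show ?thesis using reset_live[of j m'] assms by auto
qed

text \<open>The drift argument for a chain killed at 0: one iteration multiplies the expected
  potential by at most \<rho>. The drift is assumed on live states only, which carry all the
  mass.\<close>

lemma run_drift:
  assumes j: "j \<ge> 1" and V0: "V 0 = 0" and \<rho>: "\<rho> \<ge> 0"
    and drift: "\<And>m. m \<in> live j \<Longrightarrow> expected_next j V m \<le> \<rho> * V m"
  shows "(\<Sum>m\<in>{- int j..int j} - {0}. run j t m * V m) \<le> \<rho> ^ t * V (int j)"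
proof (induction t)
  case 0
  have "(\<Sum>m\<in>{- int j..int j} - {0}. run j 0 m * V m) = (\<Sum>m\<in>{- int j..int j} - {0}. if m = int j then V m else 0)"
    by (intro sum.cong) auto
  also have "\<dots> = V (int j)" using j by (simp add: sum.delta)
  finally show ?case by simp
next
  case (Suc t)
  let ?S = "{- int j..int j} - {0}"
  have "(\<Sum>m''\<in>?S. run j (Suc t) m'' * V m'') = (\<Sum>m\<in>?S. \<Sum>m''\<in>?S. run j t m * (step_prob j m m'' * V m''))"
    unfolding run.simps sum_distrib_right by (subst sum.swap) (simp add: mult_ac)
  also have "\<dots> = (\<Sum>m\<in>?S. run j t m * expected_next j V m)"
    by (simp only: sum_distrib_left[symmetric] sum_step_prob[where V = V, OF V0])
  also have "\<dots> \<le> (\<Sum>m\<in>?S. run j t m * (\<rho> * V m))"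
  proof (rule sum_mono)
    fix m assume m: "m \<in> ?S"
    show "run j t m * expected_next j V m \<le> run j t m * (\<rho> * V m)"
    proof (cases "run j t m = 0")
      case False
      then show ?thesis using drift[OF run_live[OF j m False]] run_nonneg by (intro mult_left_mono)
    qed simp
  qed
  also have "\<dots> = \<rho> * (\<Sum>m\<in>?S. run j t m * V m)" by (simp add: sum_distrib_left mult_ac)
  also have "\<dots> \<le> \<rho> * (\<rho> ^ t * V (int j))" using Suc \<rho> by (rule mult_left_mono)
  finally show ?case by (simp add: mult_ac)
qed

lemma still_running_nonneg: "still_running j t \<ge> 0"
  unfolding still_running_def by (intro sum_nonneg run_nonneg)

text \<open>Markov's inequality: on live states \<open>V\<close> dominates the indicator of not
  having stopped.\<close>

lemma still_running_drift:
  assumes j: "j \<ge> 1" and V0: "V 0 = 0" and \<rho>: "\<rho> \<ge> 0"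
    and drift: "\<And>m. m \<in> live j \<Longrightarrow> expected_next j V m \<le> \<rho> * V m"
    and V1: "\<And>m. m \<in> live j \<Longrightarrow> V m \<ge> 1"
  shows "still_running j t \<le> \<rho> ^ t * V (int j)"
proof -
  have "still_running j t \<le> (\<Sum>m\<in>{- int j..int j} - {0}. run j t m * V m)"
    unfolding still_running_def
  proof (rule sum_mono)
    fix m assume m: "m \<in> {- int j..int j} - {0}"
    show "run j t m \<le> run j t m * V m"
    proof (cases "run j t m = 0")
      case False
      then show ?thesis using V1[OF run_live[OF j m False]] run_nonneg[of j t m] by (simp add: mult_le_cancel_left1)
    qed simp
  qed
  also have "\<dots> \<le> \<rho> ^ t * V (int j)" by (rule run_drift[OF j V0 \<rho> drift])
  finally show ?thesis .
qed

lemma live_range: "m \<in> live j \<Longrightarrow> m \<in> {- int j..int j}"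
  by (simp add: live_def)

text \<open>The drift bound with that indicator as potential and \<rho> = 1.\<close>

lemma still_running_le_1:
  assumes "j \<ge> 1"
  shows "still_running j t \<le> 1"
proof -
  define V :: "int \<Rightarrow> real" where "V m = (if m = 0 then 0 else 1)" for m
  have "expected_next j V m \<le> 1 * V m" if "m \<in> live j" for m
  proof -
    have "expected_next j V m \<le> (\<Sum>m'\<in>{- int j..int j}. meas_prob j (theta j m) m m')"
      unfolding expected_next_def V_def by (intro sum_mono) (simp add: meas_prob_nonneg)
    also have "\<dots> = 1" by (rule sum_meas_prob_1[OF live_range[OF that]])
    finally show ?thesis using that by (simp add: V_def live_def)
  qed
  then have "still_running j t \<le> 1 ^ t * V (int j)"
    by (intro still_running_drift[where V = V] assms) (simp_all add: V_def live_def)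
  then show ?thesis using assms by (simp add: V_def)
qed

section \<open>Geometric decay at an absolute rate for large j\<close>

lemma theta_self: "j \<ge> 1 \<Longrightarrow> theta j (int j) = pi / 2"
  by (simp add: theta_def)

text \<open>The angle is pi/2 or -pi/2, so the mean vanishes and only the variance remains. The case
  m = -j serves j = 1, where -1 is live.\<close>

lemma second_moment_start:
  assumes "j \<ge> 1" "\<bar>m\<bar> = int j"
  shows "(\<Sum>m'\<in>{- int j..int j}. meas_prob j (theta j m) m m' * (real_of_int m')\<^sup>2) = real j / 2"
proof -
  have m: "m \<in> {- int j..int j}" using assms(2) by auto
  have sq: "(real_of_int m)\<^sup>2 = (real j)\<^sup>2"
    using assms(2) by (metis of_int_abs of_int_of_nat_eq power2_abs)
  have "(cos (theta j m))\<^sup>2 = 0"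
    unfolding cos_theta(1)[OF assms(1) m] power_divide sq using assms(1) by simp
  then show ?thesis
    unfolding second_moment[OF m] sq by (simp add: power_mult_distrib power2_eq_square algebra_simps)
qed

text \<open>AM-GM for 1, 1, 1 and s^4, where s^2 = y / sqrt J. It reduces the expected root to the
  second moment.\<close>

lemma sqrt_sqrt_amgm:
  fixes J y :: real
  assumes "J > 0" "y \<ge> 0"
  shows "sqrt y \<le> sqrt (sqrt J) * ((3 + y\<^sup>2 / J) / 4)"
proof -
  define s where "s = sqrt (y / sqrt J)"
  have s0: "s \<ge> 0" using assms by (simp add: s_def)
  have s2: "s^2 = y / sqrt J" using assms by (simp add: s_def)
  have "s^4 = (s^2)^2" by simp
  also have "\<dots> = y\<^sup>2 / J" unfolding s2 using assms by (simp add: power_divide)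
  finally have s4: "s^4 = y\<^sup>2 / J" .
  have "0 \<le> (s - 1)^2 * ((s + 1)^2 + 2)" by simp
  also have "\<dots> = s^4 - 4 * s + 3" by algebra
  finally have "s \<le> (3 + s^4) / 4" by simp
  moreover have "sqrt y = sqrt (sqrt J) * s"
    using assms by (simp add: s_def real_sqrt_mult[symmetric])
  ultimately show ?thesis unfolding s4 using assms by (simp add: mult_left_mono)
qed

lemma still_running_large:
  assumes j: "j \<ge> 10000"
  shows "still_running j t \<le> (995/1000) ^ t * sqrt (sqrt (real j))"
proof -
  define F where "F = sqrt (sqrt (real j))"
  define V where "V m = min (sqrt \<bar>real_of_int m\<bar>) F" for m
  have F1: "F \<ge> 1" using j by (simp add: F_def)
  \<comment> \<open>The cap \<open>F\<close> is the root of the reset threshold: an outcome that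
    triggers the reset already has a root above \<open>F\<close>, so resetting never raises the
    potential beyond the root of the outcome.\<close>
  have reset_le: "V (reset j m') \<le> sqrt \<bar>real_of_int m'\<bar>" for m'
    by (auto simp: V_def reset_def F_def min_le_iff_disj)
  have next_le: "expected_next j V m \<le> (\<Sum>m'\<in>{- int j..int j}. meas_prob j (theta j m) m m' * sqrt \<bar>real_of_int m'\<bar>)" for m
    unfolding expected_next_def by (intro sum_mono mult_left_mono reset_le meas_prob_nonneg)
  have V1: "V m \<ge> 1" if "m \<in> live j" for m
  proof -
    have "1 \<le> \<bar>m\<bar>" using that by (auto simp: live_def)
    then have "1 \<le> \<bar>real_of_int m\<bar>" by linarith
    then show ?thesis using F1 by (simp add: V_def)
  qed
  have drift: "expected_next j V m \<le> 995/1000 * V m" if live: "m \<in> live j" for m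
  proof (cases "(real_of_int m)\<^sup>2 \<le> real j")
    case True
    then have "\<bar>real_of_int m\<bar> \<le> sqrt (real j)" by (simp add: real_le_rsqrt)
    then have V: "V m = sqrt \<bar>real_of_int m\<bar>" by (simp add: V_def F_def)
    show ?thesis unfolding V
      using live j True by (intro order_trans[OF next_le expectation_sqrt]) (auto simp: live_def)
  next
    case False
    then have m: "m = int j" using live by (simp add: live_def)
    let ?p = "meas_prob j (theta j m) m"
    have "sqrt (real j) \<le> real j" using j by (simp add: real_le_lsqrt power2_eq_square)
    then have V: "V m = F" by (simp add: V_def F_def m)
    have "expected_next j V m \<le> (\<Sum>m'\<in>{- int j..int j}. ?p m' * (F * ((3 + (real_of_int m')\<^sup>2 / real j) / 4)))"
      using sqrt_sqrt_amgm[of "real j"] j unfolding F_def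
      by (intro order_trans[OF next_le sum_mono] mult_left_mono meas_prob_nonneg)
        (metis abs_ge_zero of_nat_0_less_iff power2_abs order.strict_trans2 zero_less_numeral)
    also have "\<dots> = F * 3 / 4 * (\<Sum>m'\<in>{- int j..int j}. ?p m') + F / (4 * real j) * (\<Sum>m'\<in>{- int j..int j}. ?p m' * (real_of_int m')\<^sup>2)"
      unfolding sum_distrib_left sum.distrib[symmetric]
      using j by (intro sum.cong refl) (simp add: field_simps)
    \<comment> \<open>3/4 plus 1/4 of the normalized second moment 1/2.\<close>
    also have "\<dots> = F * 7 / 8"
      using j second_moment_start[of j m] sum_meas_prob_1[OF live_range[OF live]] m
      by (simp add: field_simps)
    finally show ?thesis unfolding V using F1 by simp
  qed
  have "still_running j t \<le> (995/1000) ^ t * V (int j)"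
  proof (rule still_running_drift)
    show "V 0 = 0" using F1 by (simp add: V_def)
  qed (use j V1 drift in auto)
  also have "\<dots> \<le> (995/1000) ^ t * F" by (intro mult_left_mono) (auto simp: V_def)
  finally show ?thesis by (simp add: F_def)
qed

section \<open>Geometric decay for fixed j\<close>

lemma meas_prob_top_0_pos:
  assumes "j \<ge> 1"
  shows "meas_prob j (theta j (int j)) (int j) 0 > 0"
proof -
  \<comment> \<open>The start state has weight 0, so only the constant coefficients of the row
    polynomials enter.\<close>
  have "shell_sum (qubit_rot (pi/2)) (2*j) j 0 = cos (pi/4) ^ j * sin (pi/4) ^ j"
    by (simp add: shell_sum_def coeff_mult coeff_linear_power_all qubit_rot_def)
  also have "\<dots> \<noteq> 0" by (simp add: cos_45 sin_45)
  finally show ?thesis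
    using assms by (subst meas_prob_eq_shell_prob) (auto simp: theta_self shell_prob_def)
qed

text \<open>On a finite set the largest ratio is attained, so strict inequalities yield one factor
  below 1.\<close>

lemma uniform_ratio:
  fixes f g :: "'a \<Rightarrow> real"
  assumes "finite S" "\<And>x. x \<in> S \<Longrightarrow> f x < g x" "\<And>x. x \<in> S \<Longrightarrow> g x > 0"
  obtains \<rho> where "0 \<le> \<rho>" "\<rho> < 1" "\<And>x. x \<in> S \<Longrightarrow> f x \<le> \<rho> * g x"
proof
  \<comment> \<open>Inserting 0 makes the factor nonnegative and covers an empty set.\<close>
  let ?\<rho> = "Max (insert 0 ((\<lambda>x. f x / g x) ` S))"
  show "0 \<le> ?\<rho>" using assms(1) by (intro Max_ge) auto
  show "?\<rho> < 1" using assms by (subst Max_less_iff) auto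
  fix x assume x: "x \<in> S"
  then have "f x / g x \<le> ?\<rho>" using assms(1) by (intro Max_ge) auto
  then show "f x \<le> ?\<rho> * g x" using assms(3)[OF x] by (simp add: pos_divide_le_eq)
qed

text \<open>For fixed \<open>j\<close> the rate may depend on \<open>j\<close>. The second moment of the outcome exceeds \<open>m\<^sup>2\<close>,
  so the potential \<open>1 + \<epsilon> (j\<^sup>2 - m\<^sup>2)\<close> decreases, even when the reset counts as reaching \<open>\<bar>m\<bar> = j\<close>.\<close>

lemma still_running_geometric:
  assumes j: "j \<ge> 1"
  obtains \<rho> where "0 \<le> \<rho>" "\<rho> < 1" "\<And>t. still_running j t \<le> \<rho> ^ t"
proof -
  define p0 where "p0 = meas_prob j (theta j (int j)) (int j) 0"
  \<comment> \<open>From m = j the potential can rise from 1 to at most 1 + \<epsilon> j^2 = 1 +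
    p0/2, while mass \<open>p0\<close> terminates; (1 - p0) (1 + p0/2) < 1 settles this
    case.\<close>
  define \<epsilon> where "\<epsilon> = p0 / (2 * (real j)\<^sup>2)"
  define V where "V m = (if m = 0 then 0 else 1 + \<epsilon> * ((real j)\<^sup>2 - (real_of_int m)\<^sup>2))" for m
  have p0: "p0 > 0" unfolding p0_def by (rule meas_prob_top_0_pos[OF j])
  then have \<epsilon>: "\<epsilon> > 0" using j by (simp add: \<epsilon>_def)
  have le_sq: "(real_of_int m)\<^sup>2 \<le> (real j)\<^sup>2" if "m \<in> {- int j..int j}" for m
  proof -
    have "\<bar>real_of_int m\<bar> \<le> real j" using that by auto
    then show ?thesis using abs_le_square_iff[of "real_of_int m" "real j"] by simp
  qed
  have V1: "V m \<ge> 1" if "m \<in> live j" for m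
    using le_sq[OF live_range[OF that]] \<epsilon> that by (simp add: V_def live_def)
  have reset_le: "V (reset j m') \<le> 1 + \<epsilon> * ((real j)\<^sup>2 - (real_of_int m')\<^sup>2)" if "m' \<in> {- int j..int j}" for m'
    using le_sq[OF that] \<epsilon> j by (auto simp: V_def reset_def add_nonneg_nonneg)
  have "expected_next j V m < V m" if live: "m \<in> live j" for m
  proof -
    note m = live_range[OF live]
    let ?p = "meas_prob j (theta j m) m"
    consider "m = int j" | "m = - int j" "m \<noteq> int j" | "\<bar>m\<bar> \<noteq> int j" by linarith
    then show ?thesis
    proof cases
      case 1
      have 0: "0 \<in> {- int j..int j}" by simp
      have r0: "reset j 0 = 0" by (simp add: reset_def)
      have "expected_next j V m = ?p 0 * V (reset j 0) + (\<Sum>m'\<in>{- int j..int j} - {0}. ?p m' * V (reset j m'))"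
        unfolding expected_next_def by (rule sum.remove) (use 0 in auto)
      also have "\<dots> = (\<Sum>m'\<in>{- int j..int j} - {0}. ?p m' * V (reset j m'))" unfolding r0 by (simp add: V_def)
      also have "\<dots> \<le> (\<Sum>m'\<in>{- int j..int j} - {0}. ?p m' * (1 + p0 / 2))"
      proof (intro sum_mono mult_left_mono meas_prob_nonneg)
        fix m' assume m': "m' \<in> {- int j..int j} - {0}"
        have "V (reset j m') \<le> 1 + \<epsilon> * ((real j)\<^sup>2 - (real_of_int m')\<^sup>2)" using m' by (intro reset_le) auto
        also have "\<dots> \<le> 1 + \<epsilon> * (real j)\<^sup>2" using \<epsilon> by simp
        also have "\<dots> = 1 + p0 / 2" using j by (simp add: \<epsilon>_def)
        finally show "V (reset j m') \<le> 1 + p0 / 2" .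
      qed
      also have "\<dots> = (\<Sum>m'\<in>{- int j..int j} - {0}. ?p m') * (1 + p0 / 2)" by (simp add: sum_distrib_right)
      also have "(\<Sum>m'\<in>{- int j..int j} - {0}. ?p m') = 1 - p0"
        using sum_meas_prob_1[OF m, of "theta j m"] sum.remove[of "{- int j..int j}" 0 ?p] 0
        by (simp add: p0_def 1)
      also have "(1 - p0) * (1 + p0 / 2) < 1" using p0 by (simp add: algebra_simps power2_eq_square add_pos_pos)
      also have "1 = V m" using 1 j by (simp add: V_def)
      finally show ?thesis .
    next
      case 2
      \<comment> \<open>The state -j is live only for j = 1. There the potential after the reset is
        the square of the outcome, with mean 1/2.\<close>
      then have "(real j)\<^sup>2 \<le> real j" using live by (simp add: live_def)
      then have j1: "j = 1" using j by (simp add: power2_eq_square mult_le_cancel_left1)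
      have "V (reset j m') = (real_of_int m')\<^sup>2" if "m' \<in> {- int j..int j}" for m'
      proof -
        have "m' = -1 \<or> m' = 0 \<or> m' = 1" using that j1 by auto
        then show ?thesis using j1 by (auto simp: V_def reset_def)
      qed
      then have "expected_next j V m = real j / 2"
        unfolding expected_next_def using second_moment_start[of j m] 2 j by simp
      then show ?thesis using 2 j1 by (simp add: V_def)
    next
      case 3
      then have mj: "(real_of_int m)\<^sup>2 \<le> real j" and m0: "m \<noteq> 0" using live by (auto simp: live_def)
      define J M where "J = real j" and "M = (real_of_int m)\<^sup>2"
      have "1 \<le> m\<^sup>2" using m0 by (metis int_one_le_iff_zero_less zero_less_power2)
      then have M1: "M \<ge> 1" unfolding M_def by (metis of_int_1_le_iff of_int_power)
      have MJ: "M \<le> J" using mj by (simp add: M_def J_def)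
      have "\<bar>m\<bar> < int j" using 3 m by auto
      then have "j \<ge> 2" using m0 by linarith
      then have J2: "J \<ge> 2" by (simp add: J_def)
      have "(\<Sum>m'\<in>{- int j..int j}. ?p m' * (real_of_int m')\<^sup>2) > M"
      proof -
        have c: "(cos (theta j m))\<^sup>2 = 1 - M / J\<^sup>2"
          using cos_theta(1)[OF j m] by (simp add: M_def J_def power_divide)
        \<comment> \<open>Exactly the condition for the second moment to exceed M. It follows from M
          \<le> J once J \<ge> 3; at J = 2 that bound gives only equality, so m = 1 and m = -1 are
          checked.\<close>
        have "3 * M < J * (J + 1)"
        proof (cases "j = 2")
          case True
          then have "m = 1 \<or> m = -1" using \<open>\<bar>m\<bar> < int j\<close> m0 by auto
          then show ?thesis using True by (auto simp: M_def J_def)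
        next
          case False
          then have "J \<ge> 3" using \<open>j \<ge> 2\<close> by (simp add: J_def)
          then have "J * (J + 1) \<ge> J * 4" by (intro mult_left_mono) auto
          then show ?thesis using MJ J2 by linarith
        qed
        then have "M / J\<^sup>2 * (2 * M) < M / J\<^sup>2 * (J * (J + 1) - M)"
          using M1 J2 by (intro mult_strict_left_mono) auto
        moreover have "(\<Sum>m'\<in>{- int j..int j}. ?p m' * (real_of_int m')\<^sup>2)
            = M * (1 - M / J\<^sup>2) + M / J\<^sup>2 * (J * (J + 1) - M) / 2"
          unfolding second_moment[OF m] power_mult_distrib c by (simp add: M_def J_def)
        ultimately show ?thesis by (simp add: algebra_simps)
      qed
      then have E: "\<epsilon> * (\<Sum>m'\<in>{- int j..int j}. ?p m' * (real_of_int m')\<^sup>2) > \<epsilon> * M"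
        using \<epsilon> by simp
      have "expected_next j V m \<le> (\<Sum>m'\<in>{- int j..int j}. ?p m' * (1 + \<epsilon> * (J\<^sup>2 - (real_of_int m')\<^sup>2)))"
        unfolding expected_next_def J_def by (intro sum_mono mult_left_mono meas_prob_nonneg reset_le)
      also have "\<dots> = (1 + \<epsilon> * J\<^sup>2) * (\<Sum>m'\<in>{- int j..int j}. ?p m')
          - \<epsilon> * (\<Sum>m'\<in>{- int j..int j}. ?p m' * (real_of_int m')\<^sup>2)"
        unfolding sum_distrib_left sum_subtractf[symmetric]
        by (intro sum.cong refl) (simp add: algebra_simps)
      also have "\<dots> < 1 + \<epsilon> * (J\<^sup>2 - M)"
        unfolding sum_meas_prob_1[OF m] using E by (simp add: algebra_simps)
      also have "\<dots> = V m" using m0 by (simp add: V_def M_def J_def)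
      finally show ?thesis .
    qed
  qed
  moreover have "finite (live j)" by (rule finite_subset[of _ "{- int j..int j}"]) (auto simp: live_def)
  ultimately obtain \<rho> where \<rho>: "0 \<le> \<rho>" "\<rho> < 1" "\<And>m. m \<in> live j \<Longrightarrow> expected_next j V m \<le> \<rho> * V m"
    using V1 by (elim uniform_ratio[of "live j" "expected_next j V" V]) (force intro: less_le_trans[OF zero_less_one])+
  have "still_running j t \<le> \<rho> ^ t" for t
  proof -
    have "still_running j t \<le> \<rho> ^ t * V (int j)"
    proof (rule still_running_drift)
      show "V 0 = 0" by (simp add: V_def)
    qed (use j \<rho> V1 in auto)
    then show ?thesis using j by (simp add: V_def)
  qed
  with \<rho>(1,2) show ?thesis by (rule that)
qed

section \<open>Summation over time\<close>

lemma summable_still_running: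
  assumes "j \<ge> 1"
  shows "summable (still_running j)"
proof -
  obtain \<rho> where "0 \<le> \<rho>" "\<rho> < 1" and le: "\<And>t. still_running j t \<le> \<rho> ^ t"
    using still_running_geometric[OF assms] by blast
  then have "summable (\<lambda>t. \<rho> ^ t)" by (simp add: summable_geometric)
  then show ?thesis
    by (rule summable_comparison_test'[where N = 0]) (simp add: le still_running_nonneg)
qed

text \<open>The series is cut at a time T of order ln j. Each of the first T terms is at most 1;
  from T on the geometric bound has fallen below 1, so the tail is at most 1 / (1 - 0.995) =
  200.\<close>

lemma expected_iterations_le:
  assumes j: "j \<ge> 10000"
  shows "expected_iterations j \<le> (1 / - ln (995/1000) + 201) * ln (real j)"
proof -
  define \<rho> :: real where "\<rho> = 995/1000"
  \<comment> \<open>Chosen so that \<rho>^T \<le> 1/j, which absorbs the prefactor sqrt (sqrt j)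
    \<le> j.\<close>
  define T where "T = nat \<lceil>ln (real j) / - ln \<rho>\<rceil>"
  have l: "- ln \<rho> > 0" by (simp add: \<rho>_def)
  have lj: "ln (real j) \<ge> 1"
  proof -
    have "exp 1 \<le> real j" using exp_le j by linarith
    then show ?thesis using j by (subst ln_ge_iff) auto
  qed
  have "\<rho> ^ T * sqrt (sqrt (real j)) \<le> 1"
  proof -
    have "ln (real j) / - ln \<rho> \<le> real T" unfolding T_def by linarith
    then have "ln (real j) \<le> real T * - ln \<rho>" using pos_divide_le_eq[OF l] by blast
    then have "real T * ln \<rho> \<le> - ln (real j)" by simp
    then have "exp (real T * ln \<rho>) \<le> exp (- ln (real j))" by simp
    then have "\<rho> ^ T \<le> 1 / real j"
      using j by (simp add: exp_of_nat_mult exp_minus \<rho>_def field_simps)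
    moreover have "sqrt (sqrt (real j)) \<le> real j"
    proof -
      have "sqrt (real j) \<le> real j" using j by (simp add: real_le_lsqrt power2_eq_square)
      moreover have "sqrt (sqrt (real j)) \<le> sqrt (real j)" using calculation by simp
      ultimately show ?thesis by linarith
    qed
    ultimately have "\<rho> ^ T * sqrt (sqrt (real j)) \<le> 1 / real j * real j"
      by (intro mult_mono) (auto simp: \<rho>_def)
    then show ?thesis using j by simp
  qed
  then have tail: "still_running j (t + T) \<le> \<rho> ^ t" for t
  proof -
    assume F: "\<rho> ^ T * sqrt (sqrt (real j)) \<le> 1"
    have "still_running j (t + T) \<le> \<rho> ^ t * (\<rho> ^ T * sqrt (sqrt (real j)))"
      using still_running_large[OF j, of "t + T"] by (simp add: \<rho>_def power_add)
    also have "\<dots> \<le> \<rho> ^ t * 1" using F by (intro mult_left_mono) (auto simp: \<rho>_def)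
    finally show ?thesis by simp
  qed
  have sm: "summable (still_running j)" using j by (intro summable_still_running) auto
  have "expected_iterations j = (\<Sum>t. still_running j (t + T)) + (\<Sum>t<T. still_running j t)"
    unfolding expected_iterations_def by (rule suminf_split_initial_segment[OF sm])
  also have "(\<Sum>t. still_running j (t + T)) \<le> (\<Sum>t. \<rho> ^ t)"
    using sm by (intro suminf_le tail) (auto simp: \<rho>_def summable_iff_shift intro!: summable_geometric)
  also have "(\<Sum>t. \<rho> ^ t) = 200"
    by (subst suminf_geometric) (simp_all add: \<rho>_def)
  also have "(\<Sum>t<T. still_running j t) \<le> (\<Sum>t<T. 1)"
    using j by (intro sum_mono still_running_le_1) auto
  also have "200 + (\<Sum>t<T. 1) \<le> 200 + (ln (real j) / - ln \<rho> + 1)"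
  proof -
    have "0 \<le> ln (real j) / - ln \<rho>" using l lj by (intro divide_nonneg_pos) auto
    then have "real T \<le> ln (real j) / - ln \<rho> + 1"
      unfolding T_def using of_int_ceiling_le_add_one[of "ln (real j) / - ln \<rho>"]
      by (subst of_nat_nat) simp_all
    then show ?thesis by simp
  qed
  \<comment> \<open>The constant 201 is the tail 200 plus 1 for rounding T up; ln j \<ge> 1 turns it
    into a multiple of ln j.\<close>
  also have "\<dots> \<le> (1 / - ln \<rho> + 201) * ln (real j)"
    using lj by (simp add: algebra_simps)
  finally show ?thesis by (simp add: \<rho>_def)
qed

text \<open>Convergence to 0 is almost sure termination, and the loop stops only at m = 0, in the
  state |j,0>. Summability makes the infinite sum in \<open>expected_iterations\<close> a genuine
  finite expectation.\<close>

theorem theorem1: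
  shows "(\<forall>j::nat. j \<ge> 1 \<longrightarrow>
            still_running j \<longlonglongrightarrow> 0 \<and> summable (still_running j))
         \<and> expected_iterations \<in> O(\<lambda>j. ln (real j))"
proof (intro conjI allI impI)
  fix j :: nat assume "j \<ge> 1"
  then show "summable (still_running j)" by (rule summable_still_running)
  then show "still_running j \<longlonglongrightarrow> 0" by (rule summable_LIMSEQ_zero)
next
  show "expected_iterations \<in> O(\<lambda>j. ln (real j))"
  proof (rule bigoI[where c = "1 / - ln (995/1000) + 201"], rule eventually_sequentiallyI[of 10000])
    fix j :: nat assume j: "10000 \<le> j"
    have "expected_iterations j \<ge> 0"
      unfolding expected_iterations_def using j
      by (intro suminf_nonneg summable_still_running still_running_nonneg) auto
    then show "norm (expected_iterations j) \<le> (1 / - ln (995/1000) + 201) * norm (ln (real j))"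
      using expected_iterations_le[OF j] j by simp
  qed
qed

end
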